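(* Let $\beta_1,\beta_2\in(1,2)$ with $\beta_1\ne\beta_2$. (i) The set $\mathcal D_{\beta_1,\beta_2}$ is non-empty. (ii) If $\min\{\beta_1,\beta_2\}<\frac{1+\sqrt5}{2}$, then the Hausdorff dimension of $\mathcal D_{\beta_1,\beta_2}$ is positive. (iii) If $\max\{\beta_1,\beta_2\}<1.202$, then there exists $\delta>0.664$ such that $[-\delta,\delta]\subset\mathcal D_{\beta_1,\beta_2}$.
   Context: For $\beta_1,\beta_2>1$ define \[\mathcal D_{\beta_1,\beta_2}=\left\{x\in\mathbb R:\ \exists (a_n)_{n\ge1}\in\{-1,1\}^{\mathbb N}\text{ such that } x=\sum_{n=1}^\infty a_n\beta_1^{-n}=\sum_{n=1}^\infty a_n\beta_2^{-n}\right\}.\] *)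

theory Defs
  imports "HOL-Analysis.Analysis"
begin

definition D_set :: "real \<Rightarrow> real \<Rightarrow> real set" where
  "D_set \<beta>1 \<beta>2 =
     {x. \<exists>a :: nat \<Rightarrow> real. (\<forall>n\<ge>1. a n \<in> {-1, 1}) \<and>
           (\<lambda>n. a (Suc n) / \<beta>1 ^ Suc n) sums x \<and>
           (\<lambda>n. a (Suc n) / \<beta>2 ^ Suc n) sums x}"

(* |U|^s with the usual conventions |{}|^s = 0 and |U|^0 = 1 for nonempty U;
   the case split on s is needed since 0 powr 0 = 0 in HOL.
   Only used for bounded U, because diameter is unspecified for unbounded sets. *)
definition diameter_power :: "real \<Rightarrow> 'a::metric_space set \<Rightarrow> ennreal" where
  "diameter_power s U =
     (if U = {} then 0 else if s = 0 then 1 else ennreal (diameter U powr s))"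

definition hausdorff_premeasure :: "real \<Rightarrow> real \<Rightarrow> 'a::metric_space set \<Rightarrow> ennreal" where
  "hausdorff_premeasure s \<epsilon> A =
     (INF U \<in> {U :: nat \<Rightarrow> 'a set. A \<subseteq> (\<Union>i. U i) \<and>
                 (\<forall>i. bounded (U i) \<and> diameter (U i) \<le> \<epsilon>)}.
        \<Sum>i. diameter_power s (U i))"

definition hausdorff_measure :: "real \<Rightarrow> 'a::metric_space set \<Rightarrow> ennreal" where
  "hausdorff_measure s A = (SUP \<epsilon>\<in>{0<..}. hausdorff_premeasure s \<epsilon> A)"

definition hausdorff_dim :: "'a::metric_space set \<Rightarrow> ennreal" where
  "hausdorff_dim A = (INF s\<in>{s. 0 \<le> s \<and> hausdorff_measure s A = 0}. ennreal s)"

end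

theory Submission
  imports Defs
begin

text \<open>
  Let \<open>b < c\<close> be the two bases. Choosing digits \<open>e\<^sub>0, e\<^sub>1, \<dots>\<close> one at a time is steering an
  expanding recursion: the sum of \<open>e\<^sub>k m\<^sub>k / b^(k+1)\<close> is \<open>x\<close> as soon as the rescaled remainder
  \<open>t \<mapsto> b t - e\<^sub>n m\<^sub>n\<close>, started at \<open>x\<close>, stays bounded (\<open>residual_bounded_imp_sums\<close>). Every part
  of the theorem chooses digits by feedback so that some such remainder stays bounded.

  Non-emptiness. The two expansions agree iff the sum of \<open>e\<^sub>k (b^-(k+1) - c^-(k+1))\<close> vanishes, that is,
  iff the remainder with \<open>x = 0\<close> and \<open>m\<^sub>k = \<mu> (k+1)\<close>, \<open>\<mu> k = 1 - (b/c)^k\<close>, stays bounded. Taking the sign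
  of the remainder as next digit keeps its modulus at most \<open>\<mu> n / (c - 1)\<close> (\<open>sign_digits_state_bound\<close>).

  Small bases. If \<open>\<beta>^(m+1) = A \<beta>^m - B\<close> holds at \<open>\<beta> = b\<close> and \<open>\<beta> = c\<close> with \<open>A, B \<ge> 0\<close> and \<open>A + B \<le> 2\<close>,
  then the recursion \<open>v\<^sub>n = A v\<^sub>(n-1) - B v\<^sub>(n-1-m) - e\<^sub>n\<close> with sign digits stays in \<open>[-1, 1]\<close>, and its
  digits expand the starting value in both bases at once (\<open>interval_subset_D_set\<close>, a sigma-delta
  quantizer). For bases up to \<open>1.202\<close> the choice \<open>m = 7\<close> works (\<open>two_term_coefficients\<close>), which gives
  the interval \<open>[-1, 1]\<close>.

  Positive dimension. Below the golden ratio the remainder can be brought, within a bounded number of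
  steps, into an inner window where both digits are admissible (\<open>steer\<close>). This alone only yields many
  digit sequences, and different sequences may represent the same point. The heart of the proof
  is that two branches can be continued so that they do represent different points. Summation by parts
  (\<open>val_increment\<close>) expresses the difference of the two points as a negative multiple of the weighted
  sum of the differences \<open>D\<^sub>k\<close> of the two remainders. Start with \<open>D \<approx> 2\<close> and use equal digits in both
  branches whenever that is admissible: then \<open>D\<close> is multiplied by \<open>b\<close> at each step, except when it is
  already large and is moved by about \<open>2\<close> towards the other sign. So \<open>D\<close> becomes negative late, if at all,
  and only moderately while the weights are still large, and the weighted sum stays positive (\<open>weighted_sum_lower_bound\<close>). Repeating such forks at regular times
  produces a Cantor set in which points whose codes first differ at position \<open>i\<close> are at least
  \<open>\<kappa> q^i\<close> apart. Reading the code as a binary expansion is then a Hoelder map onto \<open>[-1, 1]\<close>, which forces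
  positive Hausdorff dimension (\<open>hausdorff_dim_pos_if_separated\<close>).
\<close>

section \<open>Digit expansions and bounded residuals\<close>

text \<open>The part of \<open>x\<close> not yet represented by the first \<open>n\<close> digits, rescaled by \<open>b ^ n\<close>. The weights \<open>m\<close> are
there because the comparison of two bases is an expansion of \<open>0\<close> in one base with digits \<open>\<plusminus> m n\<close>.\<close>

primrec residual :: "real \<Rightarrow> (nat \<Rightarrow> real) \<Rightarrow> real \<Rightarrow> (nat \<Rightarrow> real) \<Rightarrow> nat \<Rightarrow> real" where
  "residual b m x e 0 = x"
| "residual b m x e (Suc n) = b * residual b m x e n - e n * m n"

definition is_digits :: "(nat \<Rightarrow> real) \<Rightarrow> bool" where
  "is_digits e \<longleftrightarrow> (\<forall>n. e n \<in> {-1, 1})"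

definition sign_digit :: "real \<Rightarrow> real" where
  "sign_digit t = (if t \<ge> 0 then 1 else -1)"

lemma is_digits_abs: "is_digits e \<Longrightarrow> \<bar>e n\<bar> = 1"
  unfolding is_digits_def by (metis abs_1 abs_minus_cancel empty_iff insert_iff)

lemma residual_eq:
  assumes "b \<noteq> 0"
  shows "residual b m x e n = b ^ n * (x - (\<Sum>k<n. e k * m k / b ^ Suc k))"
proof (induction n)
  case (Suc n)
  define z where "z = e n * m n / b ^ Suc n"
  have "e n * m n = b * b ^ n * z" using assms by (simp add: z_def)
  moreover have "(\<Sum>k<Suc n. e k * m k / b ^ Suc k) = (\<Sum>k<n. e k * m k / b ^ Suc k) + z"
    by (simp add: z_def)
  ultimately show ?case unfolding residual.simps Suc by (simp add: algebra_simps)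
qed simp

lemma residual_cong:
  assumes "\<And>k. k < n \<Longrightarrow> e k = e' k"
  shows "residual b m x e n = residual b m x e' n"
  using assms by (induction n) auto

text \<open>The rescaling by \<open>b ^ n\<close> turns the convergence of an expansion into the boundedness of a recursion.\<close>

lemma residual_bounded_imp_sums:
  assumes "b > 1" and bd: "\<And>n. \<bar>residual b m x e n\<bar> \<le> C"
  shows "(\<lambda>k. e k * m k / b ^ Suc k) sums x"
proof -
  have "(\<Sum>k<n. e k * m k / b ^ Suc k) = x - residual b m x e n * (1 / b) ^ n" for n
    using assms residual_eq[of b m x e n] by (simp add: power_one_over field_simps)
  moreover have "(\<lambda>n. residual b m x e n * (1 / b) ^ n) \<longlonglongrightarrow> 0"
  proof (rule Lim_null_comparison)
    show "\<forall>\<^sub>F n in sequentially. norm (residual b m x e n * (1 / b) ^ n) \<le> C * (1 / b) ^ n"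
      using assms by (auto simp: abs_mult intro!: mult_right_mono)
    have "(\<lambda>n. (1 / b) ^ n) \<longlonglongrightarrow> 0"
      using assms by (intro LIMSEQ_realpow_zero) auto
    from tendsto_mult_right_zero[OF this] show "(\<lambda>n. C * (1 / b) ^ n) \<longlonglongrightarrow> 0" .
  qed
  ultimately show ?thesis
    using tendsto_diff[OF tendsto_const[of x]] by (fastforce simp: sums_def)
qed

lemma feedback_digits:
  obtains e where "\<And>n. e n = f n (residual b m x e n)"
proof -
  define y where "y = rec_nat x (\<lambda>n y. b * y - f n y * m n)"
  define e where "e = (\<lambda>n. f n (y n))"
  have "residual b m x e n = y n" for n
    by (induction n) (auto simp: y_def e_def)
  then show ?thesis using that[of e] by (simp add: e_def)
qed

lemma sign_feedback:
  obtains e where "is_digits e" "\<And>n. e n = sign_digit (residual b m x e n)"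
proof -
  obtain e where "\<And>n. e n = sign_digit (residual b m x e n)"
    using feedback_digits[of "\<lambda>_. sign_digit" b m x] by blast
  then show ?thesis using that[of e] by (simp add: is_digits_def sign_digit_def)
qed

lemma summable_digits:
  assumes "is_digits e" "b > 1"
  shows "summable (\<lambda>k. e k / b ^ Suc k)"
proof (rule summable_comparison_test')
  show "summable (\<lambda>k. (1 / b) * (1 / b) ^ k)"
    using assms by (intro summable_mult summable_geometric) auto
  show "norm (e k / b ^ Suc k) \<le> (1 / b) * (1 / b) ^ k" for k
    using assms is_digits_abs[OF assms(1), of k] by (simp add: abs_mult power_one_over)
qed

lemma digit_tail_bound:
  assumes "is_digits e" "b > 1"
  shows "\<bar>(\<Sum>k. e k / b ^ Suc k) - (\<Sum>k<n. e k / b ^ Suc k)\<bar> \<le> 1 / ((b - 1) * b ^ n)"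
proof -
  have g: "(\<lambda>k. (1 / b ^ Suc n) * (1 / b) ^ k) sums ((1 / b ^ Suc n) * (1 / (1 - 1 / b)))"
    using assms by (intro sums_mult geometric_sums) auto
  have eq: "(\<Sum>k. e k / b ^ Suc k) - (\<Sum>k<n. e k / b ^ Suc k) = (\<Sum>k. e (k + n) / b ^ Suc (k + n))"
    using suminf_minus_initial_segment[OF summable_digits[OF assms], of n] by simp
  have "norm (\<Sum>k. e (k + n) / b ^ Suc (k + n)) \<le> (\<Sum>k. (1 / b ^ Suc n) * (1 / b) ^ k)"
  proof (rule norm_suminf_le)
    show "norm (e (k + n) / b ^ Suc (k + n)) \<le> (1 / b ^ Suc n) * (1 / b) ^ k" for k
      using assms is_digits_abs[OF assms(1), of "k + n"]
      by (simp add: abs_mult power_one_over power_add mult_ac)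
  qed (use g sums_summable in blast)
  also have "\<dots> = 1 / ((b - 1) * b ^ n)"
    unfolding sums_unique[OF g, symmetric] using assms by (simp add: field_simps)
  finally show ?thesis using eq by simp
qed

text \<open>The binary code of a Cantor set has to reach every point of an interval; digits \<open>\<plusminus>1\<close> in base \<open>2\<close> reach
\<open>[-1, 1]\<close> since the sign rule keeps the residual there.\<close>

lemma binary_digits:
  assumes "\<bar>x\<bar> \<le> 1"
  obtains e where "is_digits e" "(\<Sum>k. e k / 2 ^ Suc k) = x"
proof -
  obtain e where e: "is_digits e" "\<And>n. e n = sign_digit (residual 2 (\<lambda>_. 1) x e n)"
    using sign_feedback[of 2 "\<lambda>_. 1" x] by blast
  have "\<bar>residual 2 (\<lambda>_. 1) x e n\<bar> \<le> 1" for n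
    using assms by (induction n) (auto simp: e(2) sign_digit_def abs_le_iff)
  from residual_bounded_imp_sums[OF _ this] have "(\<lambda>k. e k * 1 / 2 ^ Suc k) sums x" by simp
  then show ?thesis using that[OF e(1)] sums_unique by fastforce
qed

lemma D_set_iff:
  "x \<in> D_set b c \<longleftrightarrow> (\<exists>e. is_digits e \<and> (\<lambda>k. e k / b ^ Suc k) sums x \<and> (\<lambda>k. e k / c ^ Suc k) sums x)"
proof
  assume "x \<in> D_set b c"
  then obtain a where a: "\<forall>n\<ge>1. a n \<in> {-1, 1}" "(\<lambda>n. a (Suc n) / b ^ Suc n) sums x"
    "(\<lambda>n. a (Suc n) / c ^ Suc n) sums x" by (auto simp: D_set_def)
  then show "\<exists>e. is_digits e \<and> (\<lambda>k. e k / b ^ Suc k) sums x \<and> (\<lambda>k. e k / c ^ Suc k) sums x"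
    by (intro exI[of _ "\<lambda>n. a (Suc n)"]) (auto simp: is_digits_def)
next
  assume "\<exists>e. is_digits e \<and> (\<lambda>k. e k / b ^ Suc k) sums x \<and> (\<lambda>k. e k / c ^ Suc k) sums x"
  then obtain e where "is_digits e" "(\<lambda>k. e k / b ^ Suc k) sums x" "(\<lambda>k. e k / c ^ Suc k) sums x"
    by blast
  then show "x \<in> D_set b c" unfolding D_set_def is_digits_def
    by (intro CollectI exI[of _ "\<lambda>n. e (n - 1)"]) auto
qed

lemma D_set_commute: "D_set b c = D_set c b"
  by (auto simp: D_set_iff)

section \<open>Two small bases: an interval of simultaneous expansions\<close>

text \<open>The recursion \<open>v\<^sub>n = A v\<^sub>(n-1) - B v\<^sub>(n-1-m) - e\<^sub>n\<close> with \<open>e\<^sub>n\<close> the sign of the first two terms never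
leaves \<open>[-1, 1]\<close>, because those two terms sum to at most \<open>A + B \<le> 2\<close> in modulus. Neither the recursion nor the
digits refer to a base. The polynomial equation says that \<open>\<beta>\<close> is a root of the characteristic
polynomial of the recursion; dividing this polynomial by the factor for \<open>\<beta>\<close> writes the residual in base
\<open>\<beta>\<close> as a fixed linear combination of the last \<open>m + 1\<close> values of \<open>v\<close>, hence it is bounded for each of the
two roots.\<close>

lemma interval_subset_D_set:
  assumes AB: "A \<ge> 0" "B \<ge> 0" "A + B \<le> 2"
    and bc: "b > 1" "c > 1" "b ^ Suc m = A * b ^ m - B" "c ^ Suc m = A * c ^ m - B"
  shows "{-1..1} \<subseteq> D_set b c"
proof
  fix x :: real assume "x \<in> {-1..1}"
  then have x: "\<bar>x\<bar> \<le> 1" by auto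
  \<comment> \<open>\<open>H n i\<close> is the value of the recursion \<open>i\<close> steps before time \<open>n\<close>; before time \<open>0\<close> all values are \<open>0\<close>.
     Carrying the history makes the recursion one of first order.\<close>
  define step where "step = (\<lambda>h :: nat \<Rightarrow> real. A * h 0 - B * h m)"
  define H where "H = rec_nat (\<lambda>i. if i = 0 then x else 0)
    (\<lambda>_ h i. case i of 0 \<Rightarrow> step h - sign_digit (step h) | Suc j \<Rightarrow> h j)"
  define e where "e = (\<lambda>n. sign_digit (step (H n)))"
  have H0: "H 0 = (\<lambda>i. if i = 0 then x else 0)" by (simp add: H_def)
  have HS: "H (Suc n) = (\<lambda>i. case i of 0 \<Rightarrow> step (H n) - e n | Suc j \<Rightarrow> H n j)" for n
    unfolding e_def by (rule ext) (simp add: H_def split: nat.split)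
  have bound: "\<bar>H n i\<bar> \<le> 1" for n i
  proof (induction n arbitrary: i)
    case 0 then show ?case using x by (simp add: H0)
  next
    case (Suc n)
    have "\<bar>A * H n 0\<bar> \<le> A * 1" "\<bar>B * H n m\<bar> \<le> B * 1"
      using Suc AB by (auto simp: abs_mult mult_left_le)
    then have "\<bar>step (H n)\<bar> \<le> 2" using AB unfolding step_def by linarith
    then have "\<bar>step (H n) - e n\<bar> \<le> 1" by (auto simp: e_def sign_digit_def abs_le_iff)
    then show ?case using Suc by (auto simp: HS split: nat.split)
  qed
  have dig: "is_digits e" by (auto simp: is_digits_def e_def sign_digit_def)
  have "(\<lambda>k. e k / \<beta> ^ Suc k) sums x" if \<beta>: "\<beta> > 1" "\<beta> ^ Suc m = A * \<beta> ^ m - B" for \<beta>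
  proof -
    have eq: "residual \<beta> (\<lambda>_. 1) x e n = H n 0 + (\<beta> - A) * (\<Sum>i<m. \<beta> ^ i * H n (Suc i))" for n
    proof (induction n)
      case 0 then show ?case by (simp add: H0)
    next
      case (Suc n)
      define P where "P = (\<Sum>i<m. \<beta> ^ i * H n i)"
      define Q where "Q = (\<Sum>i<m. \<beta> ^ i * H n (Suc i))"
      have "P + \<beta> ^ m * H n m = H n 0 + (\<Sum>i<m. \<beta> ^ Suc i * H n (Suc i))"
        using sum.lessThan_Suc[of "\<lambda>i. \<beta> ^ i * H n i" m] sum.lessThan_Suc_shift[of "\<lambda>i. \<beta> ^ i * H n i" m]
        by (simp add: P_def)
      then have s: "P = H n 0 + \<beta> * Q - \<beta> ^ m * H n m"
        by (simp add: Q_def sum_distrib_left mult.assoc)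
      have "(\<beta> - A) * \<beta> ^ m = - B" using \<beta>(2) by (simp add: algebra_simps)
      then have "(\<beta> - A) * (\<beta> ^ m * H n m) = - B * H n m" by (metis mult.assoc)
      then have "(\<beta> - A) * P = (\<beta> - A) * (H n 0 + \<beta> * Q) + B * H n m"
        unfolding s by (simp only: right_diff_distrib)
      moreover have "H (Suc n) 0 + (\<beta> - A) * (\<Sum>i<m. \<beta> ^ i * H (Suc n) (Suc i))
          = A * H n 0 - B * H n m - e n + (\<beta> - A) * P"
        by (simp add: HS step_def P_def)
      moreover have "residual \<beta> (\<lambda>_. 1) x e (Suc n) = \<beta> * (H n 0 + (\<beta> - A) * Q) - e n"
        using Suc by (simp add: Q_def)
      ultimately show ?case by (simp add: algebra_simps)
    qed
    have "\<bar>residual \<beta> (\<lambda>_. 1) x e n\<bar> \<le> 1 + \<bar>\<beta> - A\<bar> * (\<Sum>i<m. \<beta> ^ i)" for n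
    proof -
      have "\<bar>\<Sum>i<m. \<beta> ^ i * H n (Suc i)\<bar> \<le> (\<Sum>i<m. \<beta> ^ i)"
      proof (rule order.trans[OF sum_abs], rule sum_mono)
        show "\<bar>\<beta> ^ i * H n (Suc i)\<bar> \<le> \<beta> ^ i" for i
          using bound[of n "Suc i"] \<beta> by (simp add: abs_mult mult_left_le)
      qed
      then have "\<bar>(\<beta> - A) * (\<Sum>i<m. \<beta> ^ i * H n (Suc i))\<bar> \<le> \<bar>\<beta> - A\<bar> * (\<Sum>i<m. \<beta> ^ i)"
        unfolding abs_mult by (intro mult_left_mono) auto
      then show ?thesis unfolding eq using bound[of n 0] by linarith
    qed
    from residual_bounded_imp_sums[OF \<beta>(1) this] show ?thesis by simp
  qed
  then show "x \<in> D_set b c" using dig bc D_set_iff by blast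
qed

text \<open>The two equations are linear in \<open>A\<close> and \<open>B\<close>; with \<open>h = (c^7 - b^7) / (c - b)\<close> the solution is
\<open>A = c + b^7 / h\<close> and \<open>B = b^7 c^7 / h\<close>. Since \<open>h\<close> is a sum of seven monomials, bounding each of them
from below gives \<open>A + B \<le> (8 c + c^8) / 7\<close>. This is the value at a double root \<open>b = c\<close>, and it is just
below \<open>2\<close> for \<open>c = 1.202\<close>. For general \<open>m\<close> the bound is \<open>((m + 1) c + c^(m + 1)) / m\<close>, which at this \<open>c\<close>
exceeds \<open>2\<close> for \<open>m = 6\<close> and for \<open>m = 8\<close>.\<close>

lemma two_term_coefficients:
  fixes b c :: real
  assumes "1 < b" "b < c" "c \<le> 601 / 500"
  obtains A B where "A \<ge> 0" "B \<ge> 0" "A + B \<le> 2"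
    "b ^ Suc 7 = A * b ^ 7 - B" "c ^ Suc 7 = A * c ^ 7 - B"
proof -
  define h where "h = (\<Sum>i<7. c ^ i * b ^ (6 - i))"
  have h_eq: "c ^ 7 - b ^ 7 = (c - b) * h"
    unfolding h_def by (simp add: eval_nat_numeral algebra_simps)
  have h_b: "7 * b ^ 6 \<le> h"
  proof -
    have "(\<Sum>i<7::nat. b ^ 6) \<le> h" unfolding h_def
    proof (rule sum_mono)
      fix i :: nat assume "i \<in> {..<7}"
      then have "b ^ 6 = b ^ i * b ^ (6 - i)" by (simp flip: power_add)
      also have "\<dots> \<le> c ^ i * b ^ (6 - i)" using assms by (intro mult_right_mono power_mono) auto
      finally show "b ^ 6 \<le> c ^ i * b ^ (6 - i)" .
    qed
    then show ?thesis by simp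
  qed
  have h_bc: "7 * (b ^ 7 * c ^ 7) \<le> c ^ 8 * h"
  proof -
    have "(\<Sum>i<7::nat. b ^ 7 * c ^ 7) \<le> c ^ 8 * h" unfolding h_def sum_distrib_left
    proof (rule sum_mono)
      fix i :: nat assume i: "i \<in> {..<7}"
      then have "b ^ 7 * c ^ 7 = (c ^ i * b ^ (6 - i)) * (c ^ (7 - i) * b ^ Suc i)"
      proof -
        have "b ^ 7 = b ^ (6 - i) * b ^ Suc i" using i by (simp flip: power_add power_Suc)
        moreover have "c ^ 7 = c ^ i * c ^ (7 - i)" using i by (simp flip: power_add)
        ultimately show ?thesis by (simp add: mult_ac)
      qed
      also have "\<dots> \<le> (c ^ i * b ^ (6 - i)) * (c ^ (7 - i) * c ^ Suc i)"
        using assms by (intro mult_left_mono power_mono) auto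
      also have "c ^ (7 - i) * c ^ Suc i = c ^ 8" using i by (simp flip: power_add power_Suc)
      finally show "b ^ 7 * c ^ 7 \<le> c ^ 8 * (c ^ i * b ^ (6 - i))" by (simp add: mult_ac)
    qed
    then show ?thesis by simp
  qed
  have hpos: "h > 0" using h_b assms by (smt (verit) zero_less_power)
  define A where "A = c + b ^ 7 / h"
  define B where "B = b ^ 7 * c ^ 7 / h"
  have nn: "A \<ge> 0" "B \<ge> 0" using assms hpos by (auto simp: A_def B_def)
  have "b ^ 7 / h \<le> b / 7"
    using h_b hpos assms by (simp add: field_simps eval_nat_numeral)
  moreover have "B \<le> c ^ 8 / 7"
    using h_bc hpos by (simp add: B_def field_simps)
  moreover have "c ^ 8 \<le> (601 / 500) ^ 8" using assms by (intro power_mono) auto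
  moreover have "(601 / 500 :: real) ^ 8 \<le> 436 / 100" by (simp add: power_divide)
  ultimately have le: "A + B \<le> 2" using assms unfolding A_def by linarith
  have "b ^ Suc 7 = A * b ^ 7 - B" "c ^ Suc 7 = A * c ^ 7 - B"
  proof -
    have "h * (A * b ^ 7 - B) = b ^ 7 * (c * h + b ^ 7 - c ^ 7)"
      using hpos by (simp add: A_def B_def algebra_simps)
    also have "c * h + b ^ 7 - c ^ 7 = b * h" using h_eq by (simp add: algebra_simps)
    finally have "h * (A * b ^ 7 - B) = h * (b * b ^ 7)" by (simp only: mult_ac)
    then show "b ^ Suc 7 = A * b ^ 7 - B" using hpos by (simp only: power_Suc mult_left_cancel)
    have "h * (A * c ^ 7 - B) = h * (c * c ^ 7)"
      using hpos by (simp add: A_def B_def algebra_simps)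
    then show "c ^ Suc 7 = A * c ^ 7 - B" using hpos by (simp only: power_Suc mult_left_cancel)
  qed
  with nn le that show ?thesis by blast
qed

section \<open>A lower bound for the Hausdorff dimension\<close>

lemma hausdorff_dim_mono:
  assumes "A \<subseteq> B"
  shows "hausdorff_dim A \<le> hausdorff_dim B"
proof -
  have "hausdorff_premeasure s \<epsilon> A \<le> hausdorff_premeasure s \<epsilon> B" for s \<epsilon>
    unfolding hausdorff_premeasure_def by (rule INF_superset_mono) (use assms in auto)
  then have "hausdorff_measure s A \<le> hausdorff_measure s B" for s
    unfolding hausdorff_measure_def by (intro SUP_mono) auto
  then have "{s. 0 \<le> s \<and> hausdorff_measure s B = 0} \<subseteq> {s. 0 \<le> s \<and> hausdorff_measure s A = 0}"
    by (auto simp flip: le_zero_eq intro: order.trans)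
  then show ?thesis unfolding hausdorff_dim_def by (rule INF_superset_mono) simp
qed

text \<open>A Hoelder map of exponent \<open>s\<close> sends a cover of \<open>E\<close> by small sets \<open>U i\<close> to a cover of an interval by
intervals of length \<open>2 C (diameter (U i))^s\<close>, and these lengths must add up to at least \<open>2\<close>. Sets of diameter
at most \<open>1\<close> satisfy \<open>diameter^s \<le> diameter^s'\<close> for \<open>s' \<le> s\<close>, so no smaller exponent has measure \<open>0\<close>.\<close>

lemma hausdorff_dim_geI:
  fixes E :: "'a::metric_space set" and f :: "'a \<Rightarrow> real"
  assumes "s \<ge> 0" "C > 0"
    and surj: "{-1..1} \<subseteq> f ` E"
    and hoelder: "\<And>x y. x \<in> E \<Longrightarrow> y \<in> E \<Longrightarrow> \<bar>f x - f y\<bar> \<le> C * dist x y powr s"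
  shows "hausdorff_dim E \<ge> ennreal s"
proof -
  have "hausdorff_measure s' E \<noteq> 0" if s': "0 \<le> s'" "s' < s" for s'
  proof -
    have cover: "ennreal (1 / C) \<le> (\<Sum>i. diameter_power s' (U i))"
      if U: "E \<subseteq> (\<Union>i. U i)" "\<And>i. bounded (U i) \<and> diameter (U i) \<le> 1" for U :: "nat \<Rightarrow> 'a set"
    proof -
      define z where "z = (\<lambda>i. SOME z. z \<in> U i \<inter> E)"
      define rad where "rad = (\<lambda>i. C * diameter (U i) powr s)"
      define I where "I = (\<lambda>i. if U i \<inter> E = {} then {} else {f (z i) - rad i .. f (z i) + rad i})"
      have z: "z i \<in> U i \<inter> E" if "U i \<inter> E \<noteq> {}" for i
        using that unfolding z_def by (metis ex_in_conv someI_ex)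
      have "{-1..1} \<subseteq> (\<Union>i. I i)"
      proof
        fix y :: real assume "y \<in> {-1..1}"
        then obtain x i where x: "x \<in> E" "y = f x" "x \<in> U i" using surj U(1) by blast
        have "\<bar>f x - f (z i)\<bar> \<le> C * dist x (z i) powr s"
          using hoelder x z[of i] by blast
        also have "dist x (z i) \<le> diameter (U i)"
          using diameter_bounded_bound[of "U i" x "z i"] U(2)[of i] x z[of i] by blast
        then have "C * dist x (z i) powr s \<le> rad i"
          unfolding rad_def using assms(1,2) by (intro mult_left_mono powr_mono2) auto
        finally have "y \<in> I i" using x by (auto simp: I_def abs_le_iff)
        then show "y \<in> (\<Union>i. I i)" by blast
      qed
      then have "emeasure lborel {-1..1::real} \<le> emeasure lborel (\<Union>i. I i)"
        by (intro emeasure_mono) (auto simp: I_def)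
      also have "\<dots> \<le> (\<Sum>i. emeasure lborel (I i))"
        by (intro emeasure_subadditive_countably) (auto simp: I_def)
      also have "\<dots> \<le> (\<Sum>i. ennreal (2 * C) * diameter_power s' (U i))"
      proof (rule suminf_le)
        fix i
        show "emeasure lborel (I i) \<le> ennreal (2 * C) * diameter_power s' (U i)"
        proof (cases "U i \<inter> E = {}")
          case False
          then have "U i \<noteq> {}" by auto
          have d: "0 \<le> diameter (U i)" "diameter (U i) \<le> 1"
            using diameter_ge_0 U(2) by auto
          have rad: "rad i \<ge> 0" using assms by (simp add: rad_def)
          have "emeasure lborel (I i) = ennreal (2 * C * diameter (U i) powr s)"
            using False rad by (simp add: I_def) (simp add: rad_def)
          also have "\<dots> = ennreal (2 * C) * ennreal (diameter (U i) powr s)"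
            using assms by (simp add: ennreal_mult)
          also have "ennreal (diameter (U i) powr s) \<le> diameter_power s' (U i)"
          proof (cases "s' = 0")
            case True
            then show ?thesis using d assms \<open>U i \<noteq> {}\<close>
              by (simp add: diameter_power_def powr_le1)
          next
            case False
            then show ?thesis using d s' \<open>U i \<noteq> {}\<close>
              by (simp add: diameter_power_def powr_mono' ennreal_leI)
          qed
          finally show ?thesis by (simp add: mult_left_mono)
        qed (simp add: I_def)
      qed auto
      also have "\<dots> = ennreal (2 * C) * (\<Sum>i. diameter_power s' (U i))" by simp
      finally have "ennreal 2 \<le> ennreal (2 * C) * (\<Sum>i. diameter_power s' (U i))" by simp
      then have "ennreal (1 / (2 * C)) * ennreal 2
          \<le> ennreal (1 / (2 * C)) * (ennreal (2 * C) * (\<Sum>i. diameter_power s' (U i)))"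
        by (rule mult_left_mono) simp
      also have "\<dots> = (\<Sum>i. diameter_power s' (U i))"
        using assms by (simp flip: mult.assoc ennreal_mult)
      also have "ennreal (1 / (2 * C)) * ennreal 2 = ennreal (1 / C)"
        using assms by (simp flip: ennreal_mult del: ennreal_numeral)
      finally show ?thesis .
    qed
    have "0 < ennreal (1 / C)" using assms by simp
    also have "ennreal (1 / C) \<le> hausdorff_premeasure s' 1 E"
      unfolding hausdorff_premeasure_def by (rule INF_greatest) (use cover in auto)
    also have "\<dots> \<le> hausdorff_measure s' E"
      unfolding hausdorff_measure_def by (rule SUP_upper) simp
    finally show ?thesis by simp
  qed
  then show ?thesis unfolding hausdorff_dim_def
    by (intro INF_greatest ennreal_leI) (force simp: not_le)
qed

text \<open>The separation says that the inverse of the coding \<open>x\<close>, followed by reading the code in base \<open>2\<close>, is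
Hoelder continuous: codes agreeing up to \<open>i\<close> have binary values within \<open>2 / 2^i\<close>, and the exponent
\<open>s = ln 2 / ln (1/q)\<close> is the one with \<open>(q^i)^s = 1 / 2^i\<close>.\<close>

lemma hausdorff_dim_pos_if_separated:
  fixes x :: "(nat \<Rightarrow> real) \<Rightarrow> 'a::metric_space"
  assumes q: "0 < q" "q < 1" and \<kappa>: "\<kappa> > 0"
    and sep: "\<And>\<omega> \<omega>' i. is_digits \<omega> \<Longrightarrow> is_digits \<omega>' \<Longrightarrow> (\<And>k. k < i \<Longrightarrow> \<omega> k = \<omega>' k) \<Longrightarrow> \<omega> i \<noteq> \<omega>' i
      \<Longrightarrow> \<kappa> * q ^ i \<le> dist (x \<omega>) (x \<omega>')"
    and sub: "\<And>\<omega>. is_digits \<omega> \<Longrightarrow> x \<omega> \<in> E"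
  shows "hausdorff_dim E > 0"
proof -
  define s where "s = ln 2 / ln (1 / q)"
  have lnq: "ln (1 / q) > 0" using q by simp
  have s: "s > 0" using lnq by (simp add: s_def)
  have qs: "q powr s = 1 / 2"
  proof -
    have "ln q * s = - ln 2" using lnq q by (simp add: s_def ln_div field_simps)
    then show ?thesis using q by (simp add: powr_def mult.commute exp_minus)
  qed
  define \<Omega> where "\<Omega> = {\<omega>. is_digits \<omega>}"
  define val where "val = (\<lambda>\<omega>. \<Sum>k. \<omega> k / (2::real) ^ Suc k)"
  define C where "C = 2 / \<kappa> powr s"
  have first: "\<exists>i. (\<forall>k<i. \<omega> k = \<omega>' k) \<and> \<omega> i \<noteq> \<omega>' i" if "\<omega> \<noteq> \<omega>'" for \<omega> \<omega>' :: "nat \<Rightarrow> real"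
  proof -
    have "\<exists>i. \<omega> i \<noteq> \<omega>' i" using that by auto
    then show ?thesis using exists_least_iff[of "\<lambda>i. \<omega> i \<noteq> \<omega>' i"] by auto
  qed
  have hoelder: "\<bar>val \<omega> - val \<omega>'\<bar> \<le> C * dist (x \<omega>) (x \<omega>') powr s"
    if dig: "is_digits \<omega>" "is_digits \<omega>'" for \<omega> \<omega>'
  proof (cases "\<omega> = \<omega>'")
    case False
    then obtain i where i: "\<And>k. k < i \<Longrightarrow> \<omega> k = \<omega>' k" "\<omega> i \<noteq> \<omega>' i" using first by blast
    have "(\<Sum>k<i. \<omega> k / 2 ^ Suc k) = (\<Sum>k<i. \<omega>' k / 2 ^ Suc k)" using i by simp
    then have "\<bar>val \<omega> - val \<omega>'\<bar> \<le> 2 * (1 / 2 ^ i)"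
      using digit_tail_bound[OF dig(1), of 2 i] digit_tail_bound[OF dig(2), of 2 i]
      unfolding val_def by simp
    also have "1 / 2 ^ i = (q ^ i) powr s"
    proof -
      have "(q ^ i) powr s = (q powr s) ^ i"
        using q by (simp add: powr_powr powr_realpow[symmetric] mult.commute)
      then show ?thesis by (simp add: qs power_one_over)
    qed
    also have "2 * (q ^ i) powr s = C * (\<kappa> * q ^ i) powr s"
      using \<kappa> q by (simp add: C_def powr_mult)
    also have "\<dots> \<le> C * dist (x \<omega>) (x \<omega>') powr s"
      using sep[OF dig i] \<kappa> q s by (intro mult_left_mono powr_mono2) (auto simp: C_def)
    finally show ?thesis .
  qed (use \<kappa> in \<open>simp add: C_def\<close>)
  have inj: "inj_on x \<Omega>"
  proof (rule inj_onI, rule ccontr)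
    fix \<omega> \<omega>' assume *: "\<omega> \<in> \<Omega>" "\<omega>' \<in> \<Omega>" "x \<omega> = x \<omega>'" "\<omega> \<noteq> \<omega>'"
    then obtain i where "\<And>k. k < i \<Longrightarrow> \<omega> k = \<omega>' k" "\<omega> i \<noteq> \<omega>' i" using first by blast
    then have "\<kappa> * q ^ i \<le> dist (x \<omega>) (x \<omega>')" using sep[of \<omega> \<omega>' i] * by (auto simp: \<Omega>_def)
    moreover have "\<kappa> * q ^ i > 0" using \<kappa> q by simp
    ultimately show False using * by simp
  qed
  define f where "f = (\<lambda>y. if y \<in> x ` \<Omega> then val (inv_into \<Omega> x y) else 0)"
  have fx: "f (x \<omega>) = val \<omega>" if "is_digits \<omega>" for \<omega>
    using that inj by (simp add: f_def \<Omega>_def)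
  have "ennreal s \<le> hausdorff_dim (x ` \<Omega>)"
  proof (rule hausdorff_dim_geI)
    show "C > 0" using \<kappa> by (simp add: C_def)
    show "{-1..1} \<subseteq> f ` x ` \<Omega>"
    proof
      fix t :: real assume "t \<in> {-1..1}"
      then have "\<bar>t\<bar> \<le> 1" by auto
      then obtain \<omega> where "is_digits \<omega>" "val \<omega> = t" unfolding val_def by (rule binary_digits)
      then show "t \<in> f ` x ` \<Omega>" using fx by (force simp: \<Omega>_def)
    qed
    show "\<bar>f y - f y'\<bar> \<le> C * dist y y' powr s" if "y \<in> x ` \<Omega>" "y' \<in> x ` \<Omega>" for y y'
      using that hoelder fx by (auto simp: \<Omega>_def)
  qed (use s in simp)
  also have "\<dots> \<le> hausdorff_dim E"
    using sub by (intro hausdorff_dim_mono) (auto simp: \<Omega>_def)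
  finally show ?thesis using s by (metis ennreal_eq_0_iff le_zero_eq not_gr_zero not_le)
qed

section \<open>The synchronized remainder of two bases\<close>

locale two_bases =
  fixes b c :: real
  assumes b: "1 < b" and bc: "b < c" and c: "c < 2"
begin

text \<open>\<open>b^(-k) - c^(-k) = b^(-k) \<mu> k\<close>. So \<open>state e n\<close> is \<open>b^n\<close> times the amount by which the expansion in base \<open>c\<close>
exceeds that in base \<open>b\<close> after \<open>n\<close> digits.\<close>

definition \<mu> :: "nat \<Rightarrow> real" where
  "\<mu> k = 1 - (b / c) ^ k"

definition state :: "(nat \<Rightarrow> real) \<Rightarrow> nat \<Rightarrow> real" where
  "state e n = residual b (\<lambda>k. \<mu> (Suc k)) 0 e n"

definition val :: "(nat \<Rightarrow> real) \<Rightarrow> nat \<Rightarrow> real" where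
  "val e n = (\<Sum>k<n. e k / c ^ Suc k)"

lemma state_0: "state e 0 = 0" and state_Suc: "state e (Suc n) = b * state e n - e n * \<mu> (Suc n)"
  by (simp_all add: state_def)

lemma state_cong: "(\<And>k. k < n \<Longrightarrow> e k = e' k) \<Longrightarrow> state e n = state e' n"
  unfolding state_def by (rule residual_cong)

lemma val_cong: "(\<And>k. k < n \<Longrightarrow> e k = e' k) \<Longrightarrow> val e n = val e' n"
  unfolding val_def by (rule sum.cong) auto

lemma ratio: "0 < b / c" "b / c < 1"
  using b bc by auto

lemma \<mu>_mono: "k \<le> l \<Longrightarrow> \<mu> k \<le> \<mu> l"
  using ratio by (simp add: \<mu>_def power_decreasing)

lemma \<mu>_less_1: "\<mu> k < 1"
  using ratio by (simp add: \<mu>_def)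

lemma \<mu>_nonneg: "0 \<le> \<mu> k"
  using ratio by (simp add: \<mu>_def power_le_one)

lemma \<mu>_pos: "k > 0 \<Longrightarrow> 0 < \<mu> k"
  using ratio by (simp add: \<mu>_def power_less_one_iff)

lemma \<mu>_Suc: "\<mu> (Suc k) = 1 - b / c + b / c * \<mu> k"
  by (simp add: \<mu>_def algebra_simps)

lemma \<mu>_tendsto: "\<mu> \<longlonglongrightarrow> 1"
proof -
  have "(\<lambda>k. (b / c) ^ k) \<longlonglongrightarrow> 0" using ratio by (intro LIMSEQ_realpow_zero) auto
  from tendsto_diff[OF tendsto_const[of 1] this] show ?thesis by (simp add: \<mu>_def[abs_def])
qed

text \<open>It suffices to control the states along a subsequence since both series converge anyway. The Cantor
construction below provides bounds only at the ends of its blocks.\<close>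

lemma D_setI:
  assumes e: "is_digits e" and g: "filterlim g at_top sequentially"
    and bd: "\<And>i. \<bar>state e (g i)\<bar> \<le> C"
  shows "(\<Sum>k. e k / c ^ Suc k) \<in> D_set b c"
proof -
  have sb: "(\<lambda>k. e k / b ^ Suc k) sums (\<Sum>k. e k / b ^ Suc k)"
    and sc: "(\<lambda>k. e k / c ^ Suc k) sums (\<Sum>k. e k / c ^ Suc k)"
    using summable_digits[OF e] b bc by (auto intro: summable_sums)
  have "e k * \<mu> (Suc k) / b ^ Suc k = e k / b ^ Suc k - e k / c ^ Suc k" for k
    using b by (simp add: \<mu>_def power_divide field_simps)
  then have "state e n = - (b ^ n) * (\<Sum>k<n. e k / b ^ Suc k - e k / c ^ Suc k)" for n
    unfolding state_def using b by (subst residual_eq) auto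
  then have part: "(\<Sum>k<n. e k / b ^ Suc k - e k / c ^ Suc k) = - state e n * (1 / b) ^ n" for n
    using b by (simp add: power_one_over field_simps)
  have "(\<lambda>n. \<Sum>k<n. e k / b ^ Suc k - e k / c ^ Suc k)
      \<longlonglongrightarrow> (\<Sum>k. e k / b ^ Suc k) - (\<Sum>k. e k / c ^ Suc k)"
    using sums_diff[OF sb sc] by (simp add: sums_def)
  then have "(\<lambda>i. - state e (g i) * (1 / b) ^ g i)
      \<longlonglongrightarrow> (\<Sum>k. e k / b ^ Suc k) - (\<Sum>k. e k / c ^ Suc k)"
    unfolding part using g by (rule filterlim_compose)
  moreover have "(\<lambda>i. - state e (g i) * (1 / b) ^ g i) \<longlonglongrightarrow> 0"
  proof (rule Lim_null_comparison)
    show "\<forall>\<^sub>F i in sequentially. norm (- state e (g i) * (1 / b) ^ g i) \<le> C * (1 / b) ^ g i"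
      using b bd by (auto simp: abs_mult intro!: mult_right_mono)
    have "(\<lambda>n. (1 / b) ^ n) \<longlonglongrightarrow> 0"
      using b by (intro LIMSEQ_realpow_zero) auto
    from tendsto_mult_right_zero[OF filterlim_compose[OF this g]]
    show "(\<lambda>i. C * (1 / b) ^ g i) \<longlonglongrightarrow> 0" .
  qed
  ultimately have "(\<Sum>k. e k / b ^ Suc k) - (\<Sum>k. e k / c ^ Suc k) = 0"
    by (rule LIMSEQ_unique)
  then show ?thesis using sb sc e by (auto simp: D_set_iff)
qed

text \<open>The bound \<open>\<mu> n / (c - 1)\<close> propagates under the sign rule because \<open>b \<mu> n \<le> c \<mu> (n + 1)\<close>, which is where
\<open>b \<le> c\<close> enters, and because \<open>c \<le> 2\<close> keeps a single digit within the bound.\<close>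

lemma sign_digits_state_bound:
  obtains e where "is_digits e" "\<And>n. \<bar>state e n\<bar> \<le> 1 / (c - 1)"
proof -
  obtain e where e: "is_digits e" "\<And>n. e n = sign_digit (state e n)"
    using sign_feedback[of b "\<lambda>k. \<mu> (Suc k)" 0] unfolding state_def by blast
  have *: "\<bar>state e n\<bar> \<le> \<mu> n / (c - 1)" for n
  proof (induction n)
    case 0 then show ?case by (simp add: state_0 \<mu>_def)
  next
    case (Suc n)
    have "\<mu> (Suc n) \<le> \<mu> (Suc n) / (c - 1)"
    proof -
      have "\<mu> (Suc n) * (c - 1) \<le> \<mu> (Suc n) * 1"
        using \<mu>_nonneg[of "Suc n"] c by (intro mult_left_mono) auto
      then show ?thesis using b bc by (simp add: pos_le_divide_eq)
    qed
    moreover have "b * \<bar>state e n\<bar> - \<mu> (Suc n) \<le> \<mu> (Suc n) / (c - 1)"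
    proof -
      have "b * \<bar>state e n\<bar> \<le> b * (\<mu> n / (c - 1))" using Suc b by (intro mult_left_mono) auto
      also have "b * \<mu> n \<le> c * \<mu> (Suc n)" using b bc by (simp add: \<mu>_Suc field_simps)
      then have "b * (\<mu> n / (c - 1)) \<le> c * \<mu> (Suc n) / (c - 1)"
        using b bc by (simp add: divide_right_mono)
      also have "\<dots> = \<mu> (Suc n) / (c - 1) + \<mu> (Suc n)" using b bc by (simp add: field_simps)
      finally show ?thesis by simp
    qed
    moreover have "\<bar>state e (Suc n)\<bar> \<le> max (\<mu> (Suc n)) (b * \<bar>state e n\<bar> - \<mu> (Suc n))"
    proof -
      have "\<bar>state e (Suc n)\<bar> = \<bar>b * \<bar>state e n\<bar> - \<mu> (Suc n)\<bar>"
        unfolding state_Suc e(2)[of n] by (cases "0 \<le> state e n") (auto simp: sign_digit_def)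
      moreover have "0 \<le> b * \<bar>state e n\<bar>" using b by simp
      ultimately show ?thesis by linarith
    qed
    ultimately show ?case by linarith
  qed
  have "\<bar>state e n\<bar> \<le> 1 / (c - 1)" for n
  proof -
    have "\<mu> n / (c - 1) \<le> 1 / (c - 1)" using \<mu>_less_1[of n] b bc by (intro divide_right_mono) auto
    then show ?thesis using *[of n] by linarith
  qed
  then show ?thesis using that e by blast
qed

lemma D_set_nonempty: "D_set b c \<noteq> {}"
proof -
  obtain e where "is_digits e" "\<And>n. \<bar>state e n\<bar> \<le> 1 / (c - 1)"
    using sign_digits_state_bound by blast
  from D_setI[OF this(1) filterlim_ident this(2)] show ?thesis by blast
qed

text \<open>Solving the recursion for the digit, \<open>e\<^sub>k = (b s\<^sub>k - s\<^sub>(k+1)) / \<mu> (k+1)\<close>, and summing by parts. The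
coefficient of \<open>s\<^sub>k\<close> in the result collapses to a constant sign, by the identity
\<open>(b/c) \<mu> k = \<mu> (k+1) - (1 - b/c)\<close>: this is what makes the position of a point monotone in its states.\<close>

lemma val_increment:
  assumes "n > 0"
  shows "val e (n + J) - val e n = state e n / (\<mu> n * c ^ n) - state e (n + J) / (\<mu> (n + J) * c ^ (n + J))
    - (1 - b / c) * (\<Sum>j<J. state e (n + j) / (\<mu> (n + j) * \<mu> (Suc (n + j)) * c ^ (n + j)))"
proof (induction J)
  case (Suc J)
  define k where "k = n + J"
  define p where "p = c ^ k"
  have p: "p > 0" using b bc by (simp add: p_def)
  have c0: "c > 0" using b bc by simp
  have m: "\<mu> k > 0" "\<mu> (Suc k) > 0" using assms by (auto simp: k_def intro!: \<mu>_pos)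
  have cm: "c * \<mu> (Suc k) = c - b + b * \<mu> k" using c0 by (simp add: \<mu>_Suc field_simps)
  have "e k / (c * p) = state e k / (\<mu> k * p) - state e (Suc k) / (\<mu> (Suc k) * (c * p))
    - (1 - b / c) * (state e k / (\<mu> k * \<mu> (Suc k) * p))"
  proof -
    have "state e k / (\<mu> k * p) - (1 - b / c) * (state e k / (\<mu> k * \<mu> (Suc k) * p))
       = state e k * (c * \<mu> (Suc k) - (c - b)) / (c * \<mu> k * \<mu> (Suc k) * p)"
      using m p c0 by (simp add: field_simps)
    also have "\<dots> = b * state e k / (\<mu> (Suc k) * (c * p))"
      unfolding cm using m p c0 by (simp add: field_simps)
    also have "\<dots> - state e (Suc k) / (\<mu> (Suc k) * (c * p)) = e k / (c * p)"
      using m p c0 by (simp add: state_Suc flip: diff_divide_distrib)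
    finally show ?thesis by simp
  qed
  then show ?case using Suc
    by (simp add: val_def k_def[symmetric] p_def[symmetric] distrib_left)
qed simp

end

section \<open>Separated branches below the golden ratio\<close>

text \<open>States are confined to \<open>[-\<rho>, \<rho>]\<close> from time \<open>N\<close> on. When \<open>\<mu> = 1\<close> the largest invariant interval has
radius \<open>1 / (b - 1)\<close>, and an orbit inside it never leaves an end point; staying strictly inside,
as \<open>\<rho>_N\<close> demands, makes the times of return uniformly bounded. In the other direction, \<open>\<rho>_c\<close>
admits the orbit of the sign rule as a starting point; \<open>\<rho>_b\<close> says that an orbit moving towards \<open>0\<close> cannot jump
over the inner window \<open>[-(\<rho> - 1)/b, (\<rho> - 1)/b]\<close>, on which both digits are admissible; and, for \<open>b < 3/2\<close>,
\<open>\<rho>_2\<close> keeps a nonnegative difference of two coupled states nonnegative. The bound \<open>2 - 1/(b+1)\<close> is below \<open>1 / (b - 1)\<close>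
exactly when \<open>b\<close> is below the golden ratio.\<close>

locale window = two_bases +
  fixes \<rho> :: real and N :: nat
  assumes golden: "b * b < b + 1"
    and \<rho>_c: "1 / (c - 1) \<le> \<rho>" and \<rho>_b: "2 - 1 / (b + 1) \<le> \<rho>" and \<rho>_2: "b < 3 / 2 \<Longrightarrow> 2 \<le> \<rho>"
    and \<rho>_N: "(b - 1) * \<rho> < \<mu> N" and N: "999 / 1000 \<le> \<mu> N"
begin

lemma N_pos: "N > 0"
  using N by (cases N) (auto simp: \<mu>_def)

lemma \<mu>_N: "k \<ge> N \<Longrightarrow> \<mu> N \<le> \<mu> k" "k \<ge> N \<Longrightarrow> \<mu> N \<le> \<mu> (Suc k)"
  by (auto intro: \<mu>_mono)

lemma \<rho>_gt_1: "\<rho> > 1"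
proof -
  have "1 / (c - 1) > 1" using b bc c by simp
  then show ?thesis using \<rho>_c by linarith
qed

lemma keep_window:
  assumes "k \<ge> N" "\<bar>p\<bar> \<le> \<rho>"
  shows "p \<ge> 0 \<Longrightarrow> \<bar>b * p - \<mu> (Suc k)\<bar> \<le> \<rho>" "p \<le> 0 \<Longrightarrow> \<bar>b * p + \<mu> (Suc k)\<bar> \<le> \<rho>"
proof -
  have m: "(b - 1) * \<rho> \<le> \<mu> (Suc k)" "\<mu> (Suc k) \<le> 1"
    using \<rho>_N \<mu>_N(2)[OF assms(1)] \<mu>_less_1[of "Suc k"] by auto
  have "b * \<bar>p\<bar> \<le> b * \<rho>" using assms b by simp
  then have *: "b * \<bar>p\<bar> - \<mu> (Suc k) \<le> \<rho>" using m(1) by (simp add: algebra_simps)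
  have "b * \<bar>p\<bar> \<ge> 0" using b by simp
  then show "p \<ge> 0 \<Longrightarrow> \<bar>b * p - \<mu> (Suc k)\<bar> \<le> \<rho>" "p \<le> 0 \<Longrightarrow> \<bar>b * p + \<mu> (Suc k)\<bar> \<le> \<rho>"
    using * m(2) \<rho>_gt_1 \<mu>_nonneg[of "Suc k"] by (auto simp: abs_le_iff)
qed

text \<open>Admissible digits \<open>x, y\<close> for two orbits at \<open>p, q\<close> whose difference does not fall too much. The second lower
bound says that a difference is stretched by \<open>b\<close>, or else it lands above the constant \<open>2 \<rho> - 4\<close>.\<close>

definition coupled :: "nat \<Rightarrow> real \<Rightarrow> real \<Rightarrow> real \<Rightarrow> real \<Rightarrow> bool" where
  "coupled k p q x y \<longleftrightarrow> x \<in> {-1, 1} \<and> y \<in> {-1, 1} \<and>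
    \<bar>b * p - x * \<mu> (Suc k)\<bar> \<le> \<rho> \<and> \<bar>b * q - y * \<mu> (Suc k)\<bar> \<le> \<rho> \<and>
    b * (p - q) - 2 \<le> (b * p - x * \<mu> (Suc k)) - (b * q - y * \<mu> (Suc k)) \<and>
    min (b * (p - q)) (2 * \<rho> - 4) \<le> (b * p - x * \<mu> (Suc k)) - (b * q - y * \<mu> (Suc k))"

text \<open>Take equal digits if possible. Otherwise each orbit has exactly one admissible digit. If these are
\<open>1\<close> for \<open>p\<close> and \<open>-1\<close> for \<open>q\<close>, the inadmissibility of the other two choices shows \<open>b (p - q) > 2 \<rho> - 2 \<mu>\<close>, so the
difference is large before it is reduced by \<open>2 \<mu> \<le> 2\<close>. In the opposite case \<open>2 \<mu>\<close> is added
to \<open>b (p - q)\<close>.\<close>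

lemma coupled_step:
  assumes k: "k \<ge> N" and p: "\<bar>p\<bar> \<le> \<rho>" and q: "\<bar>q\<bar> \<le> \<rho>"
  shows "\<exists>x y. coupled k p q x y"
proof -
  define m where "m = \<mu> (Suc k)"
  have m: "0 \<le> m" "m \<le> 1" using \<mu>_nonneg[of "Suc k"] \<mu>_less_1[of "Suc k"] by (auto simp: m_def)
  note kp = keep_window[OF k p, folded m_def] and kq = keep_window[OF k q, folded m_def]
  consider "\<bar>b * p - m\<bar> \<le> \<rho> \<and> \<bar>b * q - m\<bar> \<le> \<rho>" | "\<bar>b * p + m\<bar> \<le> \<rho> \<and> \<bar>b * q + m\<bar> \<le> \<rho>"
    | "\<bar>b * p - m\<bar> \<le> \<rho> \<and> \<bar>b * q + m\<bar> \<le> \<rho> \<and> \<not> \<bar>b * p + m\<bar> \<le> \<rho> \<and> \<not> \<bar>b * q - m\<bar> \<le> \<rho>"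
    | "\<bar>b * p + m\<bar> \<le> \<rho> \<and> \<bar>b * q - m\<bar> \<le> \<rho>"
    using kp kq by linarith
  then show ?thesis
  proof cases
    case 1
    then show ?thesis using m by (intro exI[of _ 1]) (simp add: coupled_def m_def[symmetric] algebra_simps)
  next
    case 2
    then show ?thesis using m by (intro exI[of _ "-1"]) (simp add: coupled_def m_def[symmetric] algebra_simps)
  next
    case 3
    then have "b * p + m > \<rho>" "b * q - m < - \<rho>" using m by (auto simp: abs_le_iff)
    then show ?thesis using m 3 by (intro exI[of _ 1] exI[of _ "-1"]) (simp add: coupled_def m_def[symmetric] algebra_simps)
  next
    case 4
    then show ?thesis using m by (intro exI[of _ "-1"] exI[of _ 1]) (simp add: coupled_def m_def[symmetric] algebra_simps)
  qed
qed

lemma both_digits_allowed: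
  assumes "\<bar>t\<bar> \<le> (\<rho> - 1) / b"
  shows "\<bar>b * t - \<mu> k\<bar> \<le> \<rho>" "\<bar>b * t + \<mu> k\<bar> \<le> \<rho>"
proof -
  have "\<bar>b * t\<bar> \<le> \<rho> - 1" using assms b by (simp add: abs_mult field_simps)
  then show "\<bar>b * t - \<mu> k\<bar> \<le> \<rho>" "\<bar>b * t + \<mu> k\<bar> \<le> \<rho>"
    using \<mu>_nonneg[of k] \<mu>_less_1[of k] by (auto simp: abs_le_iff)
qed

text \<open>Outside the inner window the sign rule moves the state towards \<open>0\<close> by at least \<open>\<mu> N - (b - 1) \<rho> > 0\<close>,
and by \<open>\<rho>_b\<close> it cannot cross to the other side of the inner window.\<close>

lemma steer_within:
  assumes "is_digits a" "n \<ge> N" "\<bar>state a n\<bar> \<le> \<rho>" "\<bar>state a n\<bar> \<le> (\<rho> - 1) / b + real l * (\<mu> N - (b - 1) * \<rho>)"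
  shows "\<exists>e j. j \<le> l \<and> is_digits e \<and> (\<forall>k<n. e k = a k) \<and> \<bar>state e (n + j)\<bar> \<le> (\<rho> - 1) / b"
  using assms
proof (induction l arbitrary: a n)
  case 0
  then show ?case by (intro exI[of _ a] exI[of _ 0]) auto
next
  case (Suc l)
  show ?case
  proof (cases "\<bar>state a n\<bar> \<le> (\<rho> - 1) / b")
    case True
    then show ?thesis using Suc.prems by (intro exI[of _ a] exI[of _ 0]) auto
  next
    case False
    define t where "t = \<bar>state a n\<bar>"
    define m where "m = \<mu> (Suc n)"
    define a' where "a' = a(n := sign_digit (state a n))"
    have a': "is_digits a'" "\<And>k. k < n \<Longrightarrow> a' k = a k"
      using Suc.prems(1) by (auto simp: a'_def is_digits_def sign_digit_def)
    have "state a' n = state a n" by (rule state_cong) (use a' in auto)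
    then have state': "\<bar>state a' (Suc n)\<bar> = \<bar>b * t - m\<bar>"
      by (cases "0 \<le> state a n") (auto simp: state_Suc a'_def sign_digit_def t_def m_def)
    have m: "\<mu> N \<le> m" "m \<le> 1"
      using \<mu>_N(2)[OF Suc.prems(2)] \<mu>_less_1[of "Suc n"] by (auto simp: m_def)
    have win: "\<bar>b * t - m\<bar> \<le> \<rho>"
      using keep_window(1)[OF Suc.prems(2), of t] Suc.prems(3) by (auto simp: t_def m_def)
    have low: "b * t - m \<ge> - ((\<rho> - 1) / b)"
    proof -
      have "\<rho> - 1 \<le> b * t" using False b by (simp add: t_def field_simps)
      moreover have "\<rho> - 2 \<ge> - ((\<rho> - 1) / b)"
        using \<rho>_b b by (simp add: field_simps)
      ultimately show ?thesis using m by linarith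
    qed
    have "(b - 1) * t \<le> (b - 1) * \<rho>"
      using Suc.prems(3) b by (simp add: t_def)
    then have high: "b * t - m \<le> t - (\<mu> N - (b - 1) * \<rho>)" using m(1) by (simp add: algebra_simps)
    have "\<bar>b * t - m\<bar> \<le> (\<rho> - 1) / b + real l * (\<mu> N - (b - 1) * \<rho>)"
    proof -
      have "0 \<le> real l * (\<mu> N - (b - 1) * \<rho>)" using \<rho>_N by simp
      moreover have "b * t - m \<le> (\<rho> - 1) / b + real l * (\<mu> N - (b - 1) * \<rho>)"
        using high Suc.prems(4) by (simp add: t_def algebra_simps)
      ultimately show ?thesis using low by linarith
    qed
    then obtain e j where e: "j \<le> l" "is_digits e" "\<forall>k<Suc n. e k = a' k"
      "\<bar>state e (Suc n + j)\<bar> \<le> (\<rho> - 1) / b"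
      using Suc.IH[OF a'(1), of "Suc n"] Suc.prems(2) win unfolding state' by auto
    then show ?thesis using a' by (intro exI[of _ e] exI[of _ "Suc j"]) auto
  qed
qed

lemma steer:
  "\<exists>L. \<forall>a n. is_digits a \<longrightarrow> n \<ge> N \<longrightarrow> \<bar>state a n\<bar> \<le> \<rho> \<longrightarrow>
    (\<exists>e j. j \<le> L \<and> is_digits e \<and> (\<forall>k<n. e k = a k) \<and> \<bar>state e (n + j)\<bar> \<le> (\<rho> - 1) / b)"
proof -
  have pos: "\<mu> N - (b - 1) * \<rho> > 0" using \<rho>_N by simp
  obtain L :: nat where "\<rho> < real L * (\<mu> N - (b - 1) * \<rho>)"
    using reals_Archimedean3[OF pos] by blast
  moreover have "(\<rho> - 1) / b \<ge> 0" using \<rho>_gt_1 b by simp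
  ultimately have L: "\<rho> \<le> (\<rho> - 1) / b + real L * (\<mu> N - (b - 1) * \<rho>)" by linarith
  show ?thesis
  proof (intro exI[of _ L] allI impI)
    fix a n assume *: "is_digits a" "n \<ge> N" "\<bar>state a n\<bar> \<le> \<rho>"
    show "\<exists>e j. j \<le> L \<and> is_digits e \<and> (\<forall>k<n. e k = a k) \<and> \<bar>state e (n + j)\<bar> \<le> (\<rho> - 1) / b"
      by (rule steer_within[OF *]) (use *(3) L in linarith)
  qed
qed

text \<open>In the inner window the two orbits part with opposite digits, so that their states differ by \<open>2 \<mu>\<close>; after
that they follow \<open>coupled_step\<close> forever.\<close>

lemma coupled_digits:
  assumes a: "is_digits a" and n: "n \<ge> N" and t: "\<bar>state a n\<bar> \<le> (\<rho> - 1) / b"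
  obtains e e' where "is_digits e" "is_digits e'" "\<forall>k<n. e k = a k" "\<forall>k<n. e' k = a k"
    "\<forall>k>n. \<bar>state e k\<bar> \<le> \<rho>" "\<forall>k>n. \<bar>state e' k\<bar> \<le> \<rho>"
    "state e (Suc n) - state e' (Suc n) = 2 * \<mu> (Suc n)"
    "\<forall>k>n. b * (state e k - state e' k) - 2 \<le> state e (Suc k) - state e' (Suc k)"
    "\<forall>k>n. min (b * (state e k - state e' k)) (2 * \<rho> - 4) \<le> state e (Suc k) - state e' (Suc k)"
proof -
  obtain X Y where XY: "\<And>k p q. k \<ge> N \<Longrightarrow> \<bar>p\<bar> \<le> \<rho> \<Longrightarrow> \<bar>q\<bar> \<le> \<rho> \<Longrightarrow> coupled k p q (X k p q) (Y k p q)"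
    using coupled_step by metis
  define x where "x = (\<lambda>k (p, q). if k < n then a k else if k = n then -1 else X k p q)"
  define y where "y = (\<lambda>k (p, q). if k < n then a k else if k = n then 1 else Y k p q)"
  define S where "S = rec_nat (0, 0) (\<lambda>k s. (b * fst s - x k s * \<mu> (Suc k), b * snd s - y k s * \<mu> (Suc k)))"
  define e where "e = (\<lambda>k. x k (S k))"
  define e' where "e' = (\<lambda>k. y k (S k))"
  have e_eq: "e k = x k (S k)" "e' k = y k (S k)" for k
    by (simp_all add: e_def e'_def)
  have S: "S k = (state e k, state e' k)" for k
  proof (induction k)
    case (Suc k)
    have "S (Suc k) = (b * fst (S k) - x k (S k) * \<mu> (Suc k), b * snd (S k) - y k (S k) * \<mu> (Suc k))"
      by (simp add: S_def)
    then show ?case by (simp only: state_Suc e_eq Suc fst_conv snd_conv)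
  qed (simp add: S_def state_0)
  have ea: "e k = a k" "e' k = a k" if "k < n" for k
    using that by (simp_all add: e_eq S x_def y_def)
  have en: "e n = -1" "e' n = 1"
    by (simp_all add: e_eq S x_def y_def)
  have state_n: "state e n = state a n" "state e' n = state a n"
    by (auto intro!: state_cong simp: ea)
  have "e k = X k (state e k) (state e' k)" "e' k = Y k (state e k) (state e' k)" if "k > n" for k
    using that by (simp_all add: e_eq S x_def y_def)
  then have coupled_k: "coupled k (state e k) (state e' k) (e k) (e' k)"
    if "k > n" "\<bar>state e k\<bar> \<le> \<rho>" "\<bar>state e' k\<bar> \<le> \<rho>" for k
    using XY[of k "state e k" "state e' k"] that n by simp
  have win: "\<bar>state e k\<bar> \<le> \<rho> \<and> \<bar>state e' k\<bar> \<le> \<rho>" if "k > n" for k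
    using that
  proof (induction k)
    case (Suc k)
    show ?case
    proof (cases "k = n")
      case True
      then show ?thesis using both_digits_allowed[OF t] by (simp add: state_Suc en state_n)
    next
      case False
      then have "k > n" using Suc.prems by simp
      then show ?thesis using coupled_k[of k] Suc.IH unfolding coupled_def state_Suc by blast
    qed
  qed simp
  show ?thesis
  proof (rule that[of e e'])
    show "is_digits e" "is_digits e'"
    proof -
      have "e k \<in> {-1, 1} \<and> e' k \<in> {-1, 1}" for k
      proof (cases k n rule: linorder_cases)
        case less then show ?thesis using a ea by (simp add: is_digits_def)
      next
        case equal then show ?thesis using en by simp
      next
        case greater then show ?thesis using coupled_k[of k] win[of k] unfolding coupled_def by blast
      qed
      then show "is_digits e" "is_digits e'" unfolding is_digits_def by blast+
    qed
    show "state e (Suc n) - state e' (Suc n) = 2 * \<mu> (Suc n)" by (simp add: state_Suc en state_n)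
    show "\<forall>k>n. b * (state e k - state e' k) - 2 \<le> state e (Suc k) - state e' (Suc k)"
      "\<forall>k>n. min (b * (state e k - state e' k)) (2 * \<rho> - 4) \<le> state e (Suc k) - state e' (Suc k)"
      using coupled_k win unfolding coupled_def state_Suc by blast+
    show "\<forall>k<n. e k = a k" "\<forall>k<n. e' k = a k" using ea by blast+
    show "\<forall>k>n. \<bar>state e k\<bar> \<le> \<rho>" "\<forall>k>n. \<bar>state e' k\<bar> \<le> \<rho>" using win by blast+
  qed
qed


text \<open>If \<open>b < 3/2\<close>, then \<open>2 \<rho> - 4 \<ge> 0\<close> and no difference is ever negative. If \<open>b \<ge> 3/2\<close>, the weights \<open>c^(-j)\<close>
decay at least like \<open>(2/3)^j\<close>. The first two differences are about \<open>2\<close> and at least about \<open>1\<close>; the next three can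
be negative only moderately, which leaves enough to absorb the trivial bound \<open>4\<close> on all later ones. For \<open>b < 1.62\<close> and
\<open>\<rho> \<ge> 1.6\<close> the balance is roughly \<open>2 + 1/2 - (0.23 + 0.25 + 0.27 + 1.59) > 1/10\<close>.\<close>

lemma weighted_sum_lower_bound:
  assumes d0: "\<delta> 0 \<ge> 1998 / 1000" and bound: "\<And>j. \<bar>\<delta> j\<bar> \<le> 2 * \<rho>"
    and drop: "\<And>j. b * \<delta> j - 2 \<le> \<delta> (Suc j)" and turn: "\<And>j. min (b * \<delta> j) (2 * \<rho> - 4) \<le> \<delta> (Suc j)"
    and w: "\<And>j. 1 \<le> w j" "\<And>j. w j \<le> 1003 / 1000" and J: "J \<ge> 5"
  shows "1 / 10 \<le> (\<Sum>j<J. \<delta> j * w j * (1 / c) ^ j)"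
proof (cases "b < 3 / 2")
  case True
  have nn: "\<delta> j \<ge> 0" for j
  proof (induction j)
    case 0 then show ?case using d0 by simp
  next
    case (Suc j)
    have "b * \<delta> j \<ge> 0" using Suc b by simp
    then show ?case using turn[of j] \<rho>_2[OF True] by linarith
  qed
  have "1 / 10 \<le> \<delta> 0 * 1" using d0 by simp
  also have "\<dots> \<le> \<delta> 0 * w 0" using w(1)[of 0] nn by (intro mult_left_mono) auto
  also have "\<dots> = \<delta> 0 * w 0 * (1 / c) ^ 0" by simp
  also have "\<dots> \<le> (\<Sum>j<J. \<delta> j * w j * (1 / c) ^ j)"
  proof (rule member_le_sum)
    fix j
    have "0 \<le> w j" using w(1)[of j] by linarith
    then show "0 \<le> \<delta> j * w j * (1 / c) ^ j" using nn[of j] b bc by simp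
  qed (use J in auto)
  finally show ?thesis .
next
  case False
  define t where "t = 1 / c"
  have t: "1 / 2 \<le> t" "t \<le> 2 / 3" using False b bc c by (auto simp: t_def field_simps)
  have "b \<le> 81 / 50"
  proof (rule ccontr)
    assume "\<not> b \<le> 81 / 50"
    then have "b * b \<ge> 81 / 50 * b" by simp
    then show False using golden \<open>\<not> b \<le> 81 / 50\<close> by linarith
  qed
  have "\<rho> \<le> 2"
  proof -
    have "(b - 1) * \<rho> < 1" using \<rho>_N \<mu>_less_1[of N] by linarith
    moreover have "1 / 2 * \<rho> \<le> (b - 1) * \<rho>" using False \<rho>_gt_1 by (intro mult_right_mono) auto
    ultimately show ?thesis by linarith
  qed
  have "\<rho> \<ge> 8 / 5"
  proof -
    have "1 / (b + 1) \<le> 2 / 5" using False by (simp add: field_simps)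
    then show ?thesis using \<rho>_b by linarith
  qed
  have mult_b: "b * y \<ge> 3 / 2 * y" if "y \<ge> 0" for y
    using that False by (intro mult_right_mono) auto
  have mult_b': "b * y \<ge> 81 / 50 * z" if "z \<le> y" "z \<le> 0" for y z
  proof -
    have "81 / 50 * z \<le> b * z" using that \<open>b \<le> 81 / 50\<close> by (intro mult_right_mono_neg) auto
    also have "\<dots> \<le> b * y" using that b by (intro mult_left_mono) auto
    finally show ?thesis .
  qed
  have d1: "\<delta> 1 \<ge> 997 / 1000" 
  proof -
    have "3 / 2 * \<delta> 0 \<le> b * \<delta> 0" by (rule mult_b) (use d0 in linarith)
    then have "\<delta> (Suc 0) \<ge> 997 / 1000" using drop[of 0] d0 by linarith
    then show ?thesis by simp
  qed
  have d2: "\<delta> 2 \<ge> - (51 / 100)" 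
  proof -
    have "3 / 2 * \<delta> 1 \<le> b * \<delta> 1" by (rule mult_b) (use d1 in linarith)
    then have "\<delta> (Suc 1) \<ge> - (51 / 100)" using drop[of 1] d1 by linarith
    then show ?thesis by (simp add: numeral_2_eq_2)
  qed
  have d3: "\<delta> 3 \<ge> - (83 / 100)"
    using turn[of 2] mult_b'[OF d2] \<open>\<rho> \<ge> 8 / 5\<close> by (simp add: numeral_3_eq_3)
  have d4: "\<delta> 4 \<ge> - (135 / 100)"
    using turn[of 3] mult_b'[OF d3] \<open>\<rho> \<ge> 8 / 5\<close> by (simp add: eval_nat_numeral)
  define W where "W = (1003 / 1000 :: real)"
  have neg: "\<delta> j * w j * t ^ j \<ge> - z * W * s" if "\<delta> j \<ge> - z" "z \<ge> 0" "t ^ j \<le> s" for j z s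
  proof -
    have w0: "0 \<le> w j" "w j \<le> W" using w[of j] by (auto simp: W_def)
    have "z * w j * t ^ j \<le> z * W * s"
      using that w0 t by (intro mult_mono) auto
    moreover have "(- z) * (w j * t ^ j) \<le> \<delta> j * (w j * t ^ j)"
      using that w0 t by (intro mult_right_mono) auto
    ultimately show ?thesis by (simp add: mult.assoc)
  qed
  have tp: "t ^ j \<le> (2 / 3) ^ j" for j using t by (intro power_mono) auto
  obtain K where K: "J = 5 + K" using J le_Suc_ex by blast
  have sum_append: "(\<Sum>j<m + K. f j) = (\<Sum>j<m. f j) + (\<Sum>j<K. f (m + j))" for f :: "nat \<Rightarrow> real" and m
    by (induction K) simp_all
  have "(\<Sum>j<J. \<delta> j * w j * t ^ j)
      = (\<Sum>j<5. \<delta> j * w j * t ^ j) + (\<Sum>j<K. \<delta> (5 + j) * w (5 + j) * t ^ (5 + j))"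
    unfolding K by (rule sum_append)
  also have "(\<Sum>j<5. \<delta> j * w j * t ^ j) = \<delta> 0 * w 0 + \<delta> 1 * w 1 * t + \<delta> 2 * w 2 * t ^ 2
      + \<delta> 3 * w 3 * t ^ 3 + \<delta> 4 * w 4 * t ^ 4"
    by (simp add: eval_nat_numeral)
  finally have split: "(\<Sum>j<J. \<delta> j * w j * t ^ j) = \<delta> 0 * w 0 + \<delta> 1 * w 1 * t + \<delta> 2 * w 2 * t ^ 2
      + \<delta> 3 * w 3 * t ^ 3 + \<delta> 4 * w 4 * t ^ 4 + (\<Sum>j<K. \<delta> (5 + j) * w (5 + j) * t ^ (5 + j))" .
  have "\<delta> 0 * w 0 \<ge> 1998 / 1000 * 1" using d0 w(1)[of 0] by (intro mult_mono) auto
  moreover have "\<delta> 1 * w 1 * t \<ge> 997 / 1000 * 1 * (1 / 2)"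
    using d1 w(1)[of 1] t by (intro mult_mono) auto
  moreover have "\<delta> 2 * w 2 * t ^ 2 \<ge> - (51 / 100) * W * (4 / 9)"
    using neg[OF d2 _ tp] by (simp add: power_divide)
  moreover have "\<delta> 3 * w 3 * t ^ 3 \<ge> - (83 / 100) * W * (8 / 27)"
    using neg[OF d3 _ tp] by (simp add: power_divide)
  moreover have "\<delta> 4 * w 4 * t ^ 4 \<ge> - (135 / 100) * W * (16 / 81)"
    using neg[OF d4 _ tp] by (simp add: power_divide)
  moreover have "(\<Sum>j<K. \<delta> (5 + j) * w (5 + j) * t ^ (5 + j)) \<ge> - 4 * W * (32 / 81)"
  proof -
    have "(\<Sum>j<K. (2 / 3 :: real) ^ j) \<le> 3"
    proof -
      have "(\<Sum>j<K. (2 / 3 :: real) ^ j) = 3 - 3 * (2 / 3) ^ K" by (induction K) auto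
      then show ?thesis by simp
    qed
    then have "4 * W * (32 / 243) * (\<Sum>j<K. (2 / 3 :: real) ^ j) \<le> 4 * W * (32 / 243) * 3"
      by (intro mult_left_mono) (auto simp: W_def)
    moreover have "(\<Sum>j<K. - 4 * W * (32 / 243 * (2 / 3 :: real) ^ j))
        = - (4 * W * (32 / 243) * (\<Sum>j<K. (2 / 3 :: real) ^ j))"
      unfolding sum_distrib_left sum_negf[symmetric] by (rule sum.cong) simp_all
    ultimately have "- 4 * W * (32 / 81) \<le> (\<Sum>j<K. - 4 * W * (32 / 243 * (2 / 3 :: real) ^ j))"
      by linarith
    also have "\<dots> \<le> (\<Sum>j<K. \<delta> (5 + j) * w (5 + j) * t ^ (5 + j))"
    proof (rule sum_mono)
      fix j
      have eq: "(2 / 3 :: real) ^ (5 + j) = 32 / 243 * (2 / 3) ^ j" by (simp add: power_add power_divide)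
      have "\<delta> (5 + j) \<ge> - 4" using bound[of "5 + j"] \<open>\<rho> \<le> 2\<close> by linarith
      from neg[OF this _ tp[of "5 + j", unfolded eq]]
      show "- 4 * W * (32 / 243 * (2 / 3) ^ j) \<le> \<delta> (5 + j) * w (5 + j) * t ^ (5 + j)" by simp
    qed
    finally show ?thesis .
  qed
  ultimately show ?thesis unfolding split t_def[symmetric] by (simp add: W_def)
qed

text \<open>Two continuations up to time \<open>m\<close> of the first \<open>n\<close> digits of \<open>a\<close>. Digits after time \<open>m\<close> change each of the two points
by at most \<open>1 / ((c - 1) c^m)\<close>, so whatever follows, the points remain \<open>1 / c^m\<close> apart.\<close>

definition forks :: "(nat \<Rightarrow> real) \<Rightarrow> nat \<Rightarrow> nat \<Rightarrow> bool" where
  "forks a n m \<longleftrightarrow> (\<exists>e e'. is_digits e \<and> is_digits e' \<and> (\<forall>k<n. e k = a k) \<and> (\<forall>k<n. e' k = a k) \<and>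
    \<bar>state e m\<bar> \<le> \<rho> \<and> \<bar>state e' m\<bar> \<le> \<rho> \<and> (2 / (c - 1) + 1) / c ^ m \<le> \<bar>val e m - val e' m\<bar>)"

text \<open>By \<open>val_increment\<close> the two coupled continuations are separated by a fixed multiple of \<open>c^(-n)\<close>, up to a
boundary term of order \<open>c^(-n-J)\<close>. For large \<open>J\<close> this exceeds any prescribed multiple of \<open>c^(-n-J)\<close>.\<close>

lemma forks_from_inner_window:
  "\<exists>J\<^sub>0. \<forall>J\<ge>J\<^sub>0. \<forall>n\<ge>N. \<forall>a. is_digits a \<longrightarrow> \<bar>state a n\<bar> \<le> (\<rho> - 1) / b \<longrightarrow> forks a n (n + J)"
proof -
  define C where "C = 4 * \<rho> + 2 / (c - 1) + 1"
  define \<eta> where "\<eta> = (1 - b / c) / (10 * c)"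
  have pos: "\<eta> > 0" using ratio b bc by (simp add: \<eta>_def)
  obtain J1 where J1: "C / \<eta> < c ^ J1"
    using real_arch_pow b bc by (metis less_trans)
  have "forks a n (n + J)"
    if J: "J \<ge> max J1 6" and n: "n \<ge> N" and a: "is_digits a" "\<bar>state a n\<bar> \<le> (\<rho> - 1) / b" for J n a
  proof -
    obtain e e' where e: "is_digits e" "is_digits e'"
      "\<forall>k<n. e k = a k" "\<forall>k<n. e' k = a k"
      "\<forall>k>n. \<bar>state e k\<bar> \<le> \<rho>" "\<forall>k>n. \<bar>state e' k\<bar> \<le> \<rho>"
      "state e (Suc n) - state e' (Suc n) = 2 * \<mu> (Suc n)"
      "\<forall>k>n. b * (state e k - state e' k) - 2 \<le> state e (Suc k) - state e' (Suc k)"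
      "\<forall>k>n. min (b * (state e k - state e' k)) (2 * \<rho> - 4) \<le> state e (Suc k) - state e' (Suc k)"
      using coupled_digits[OF a(1) n a(2)] by blast
    have cpos: "c > 0" "c > 1" using b bc by auto
    obtain K where K: "J = Suc K" "K \<ge> 5" using J by (cases J) auto
    have mu: "999 / 1000 \<le> \<mu> k" if "k \<ge> n" for k
      using N \<mu>_N(1)[of k] that n by linarith
    define \<delta> where "\<delta> = (\<lambda>j. state e (Suc n + j) - state e' (Suc n + j))"
    define w where "w = (\<lambda>j. 1 / (\<mu> (Suc n + j) * \<mu> (Suc (Suc n + j))))"
    have sum: "1 / 10 \<le> (\<Sum>j<K. \<delta> j * w j * (1 / c) ^ j)"
    proof (rule weighted_sum_lower_bound)
      show "\<delta> 0 \<ge> 1998 / 1000" using e(7) mu[of "Suc n"] by (simp add: \<delta>_def)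
      show "\<bar>\<delta> j\<bar> \<le> 2 * \<rho>" for j
        using e(5)[rule_format, of "Suc n + j"] e(6)[rule_format, of "Suc n + j"] by (simp add: \<delta>_def)
      show "b * \<delta> j - 2 \<le> \<delta> (Suc j)" "min (b * \<delta> j) (2 * \<rho> - 4) \<le> \<delta> (Suc j)" for j
        using e(8)[rule_format, of "Suc n + j"] e(9)[rule_format, of "Suc n + j"] by (simp_all add: \<delta>_def)
      fix j
      define z where "z = \<mu> (Suc n + j) * \<mu> (Suc (Suc n + j))"
      have "999 / 1000 * (999 / 1000) \<le> z" "z \<le> 1 * 1" unfolding z_def
        using mu[of "Suc n + j"] mu[of "Suc (Suc n + j)"] \<mu>_less_1[of "Suc n + j"] \<mu>_less_1[of "Suc (Suc n + j)"]
        by (intro mult_mono; simp)+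
      moreover have "w j = 1 / z" by (simp add: w_def z_def)
      ultimately show "1 \<le> w j" "w j \<le> 1003 / 1000"
        by (simp_all add: pos_le_divide_eq pos_divide_le_eq)
    qed (use K in simp)
    have state_n: "state e n = state e' n" by (rule state_cong) (use e in auto)
    have val_n: "val e n = val e' n" by (rule val_cong) (use e in auto)
    define D where "D = state e (n + J) - state e' (n + J)"
    define \<Sigma> where "\<Sigma> = (\<Sum>j<K. \<delta> j * w j * (1 / c) ^ j)"
    \<comment> \<open>The terms of the sum in \<open>val_increment\<close>. The one with \<open>j = 0\<close> cancels, since both branches agree at time \<open>n\<close>.\<close>
    define g where "g = (\<lambda>x j. state x (n + j) / (\<mu> (n + j) * \<mu> (Suc (n + j)) * c ^ (n + j)))"
    define h where "h = \<mu> (n + J) * c ^ (n + J)"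
    have "val x (n + J) = val x n + state x n / (\<mu> n * c ^ n) - state x (n + J) / h - (1 - b / c) * (\<Sum>j<J. g x j)" for x
      using val_increment[of n x J] N_pos n by (simp add: g_def h_def)
    from this[of e] this[of e'] have "val e (n + J) - val e' (n + J)
        = - D / h - (1 - b / c) * ((\<Sum>j<J. g e j) - (\<Sum>j<J. g e' j))"
      unfolding D_def by (simp only: state_n val_n right_diff_distrib diff_divide_distrib minus_diff_eq)
    also have "(\<Sum>j<J. g e j) - (\<Sum>j<J. g e' j) = (\<Sum>j<J. g e j - g e' j)"
      by (simp add: sum_subtractf)
    also have "\<dots> = (\<Sum>j<K. g e (Suc j) - g e' (Suc j))"
      unfolding K(1) sum.lessThan_Suc_shift by (simp add: g_def state_n)
    also have "\<dots> = (\<Sum>j<K. \<delta> j * w j * (1 / c) ^ j / c ^ Suc n)"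
    proof (rule sum.cong[OF refl])
      fix j
      have "c ^ (n + Suc j) = c ^ j * c ^ Suc n" by (simp add: power_add)
      then show "g e (Suc j) - g e' (Suc j) = \<delta> j * w j * (1 / c) ^ j / c ^ Suc n"
        unfolding g_def \<delta>_def w_def by (simp add: power_one_over flip: diff_divide_distrib)
    qed
    also have "\<dots> = \<Sigma> / c ^ Suc n" by (simp add: \<Sigma>_def sum_divide_distrib)
    finally have diff0: "val e (n + J) - val e' (n + J) = - D / h - (1 - b / c) * (\<Sigma> / c ^ Suc n)" .
    have diff: "val e (n + J) - val e' (n + J)
        = - (D / \<mu> (n + J) + (1 - b / c) / c * \<Sigma> * c ^ J) / c ^ (n + J)"
    proof -
      have "c ^ (n + J) = c ^ n * c ^ J" "c ^ Suc n = c * c ^ n" by (simp_all add: power_add)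
      moreover have "c ^ n > 0" "c ^ J > 0" "\<mu> (n + J) > 0" using cpos mu[of "n + J"] by auto
      moreover have "- D / (y * (p * q)) - k * (z / (x * p)) = - (D / y + k / x * z * q) / (p * q)"
        if "p > 0" "q > 0" "x > 0" "y > 0" for k p q x y z :: real
        using that by (simp add: field_simps)
      ultimately show ?thesis unfolding diff0 h_def using cpos(1) by presburger
    qed
    have "\<bar>D / \<mu> (n + J)\<bar> \<le> 4 * \<rho>"
    proof -
      have "\<bar>D\<bar> \<le> 2 * \<rho>" using e(5)[rule_format, of "n + J"] e(6)[rule_format, of "n + J"] K by (simp add: D_def)
      also have "\<dots> \<le> 4 * \<rho> * \<mu> (n + J)" using mu[of "n + J"] \<rho>_gt_1 by simp
      finally show ?thesis using mu[of "n + J"] by (simp add: pos_divide_le_eq)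
    qed
    moreover have "(1 - b / c) / c * \<Sigma> * c ^ J \<ge> C"
    proof -
      have "C \<le> \<eta> * c ^ J1"
        using J1 pos by (simp add: pos_divide_less_eq mult.commute)
      also have "\<dots> \<le> \<eta> * c ^ J"
        using pos J cpos by (intro mult_left_mono power_increasing) auto
      also have "\<dots> = (1 - b / c) / c * (1 / 10) * c ^ J" by (simp add: \<eta>_def)
      also have "\<dots> \<le> (1 - b / c) / c * \<Sigma> * c ^ J"
        using sum ratio cpos by (intro mult_right_mono mult_left_mono) (auto simp: \<Sigma>_def)
      finally show ?thesis .
    qed
    ultimately have "2 / (c - 1) + 1 \<le> \<bar>D / \<mu> (n + J) + (1 - b / c) / c * \<Sigma> * c ^ J\<bar>"
      unfolding C_def by linarith
    then have "(2 / (c - 1) + 1) / c ^ (n + J) \<le> \<bar>val e (n + J) - val e' (n + J)\<bar>"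
      unfolding diff using cpos by (simp add: abs_divide divide_right_mono)
    moreover have "\<bar>state e (n + J)\<bar> \<le> \<rho>" "\<bar>state e' (n + J)\<bar> \<le> \<rho>"
      using e(5,6)[rule_format, of "n + J"] K by auto
    ultimately show ?thesis unfolding forks_def using e(1-4) by blast
  qed
  then show ?thesis by (intro exI[of _ "max J1 6"]) blast
qed

text \<open>Steering takes a varying time \<open>j \<le> L\<close>; as the coupled continuation may have any length above a threshold, the
variation is absorbed and all blocks get the same length \<open>M\<close>.\<close>

lemma forks_uniformly:
  "\<exists>M>0. \<forall>n\<ge>N. \<forall>a. is_digits a \<longrightarrow> \<bar>state a n\<bar> \<le> \<rho> \<longrightarrow> forks a n (n + M)"
proof -
  obtain L where L: "\<forall>a n. is_digits a \<longrightarrow> n \<ge> N \<longrightarrow> \<bar>state a n\<bar> \<le> \<rho> \<longrightarrow>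
    (\<exists>e j. j \<le> L \<and> is_digits e \<and> (\<forall>k<n. e k = a k) \<and> \<bar>state e (n + j)\<bar> \<le> (\<rho> - 1) / b)"
    using steer by blast
  obtain J\<^sub>0 where J: "\<forall>J\<ge>J\<^sub>0. \<forall>n\<ge>N. \<forall>a. is_digits a \<longrightarrow> \<bar>state a n\<bar> \<le> (\<rho> - 1) / b \<longrightarrow> forks a n (n + J)"
    using forks_from_inner_window by blast
  define M where "M = Suc (L + J\<^sub>0)"
  have "forks a n (n + M)" if *: "n \<ge> N" "is_digits a" "\<bar>state a n\<bar> \<le> \<rho>" for n a
  proof -
    obtain a' j where a': "j \<le> L" "is_digits a'" "\<forall>k<n. a' k = a k" "\<bar>state a' (n + j)\<bar> \<le> (\<rho> - 1) / b"
      using L * by blast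
    have M: "n + j + (M - j) = n + M" "J\<^sub>0 \<le> M - j" "N \<le> n + j"
      using a'(1) *(1) by (auto simp: M_def)
    have "forks a' (n + j) (n + j + (M - j))" using J M(2,3) a'(2,4) by blast
    then obtain e e' where "is_digits e" "is_digits e'" "\<forall>k<n+j. e k = a' k" "\<forall>k<n+j. e' k = a' k"
      "\<bar>state e (n + M)\<bar> \<le> \<rho>" "\<bar>state e' (n + M)\<bar> \<le> \<rho>"
      "(2 / (c - 1) + 1) / c ^ (n + M) \<le> \<bar>val e (n + M) - val e' (n + M)\<bar>"
      unfolding forks_def M(1) by blast
    moreover from this(3,4) have "\<forall>k<n. e k = a k" "\<forall>k<n. e' k = a k" using a'(3) by auto
    ultimately show ?thesis unfolding forks_def by blast
  qed
  moreover have "M > 0" by (simp add: M_def)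
  ultimately show ?thesis by blast
qed

text \<open>At each time \<open>l i = N + i M\<close> the code \<open>\<omega>\<close> selects one of the two continuations of a fork. The Cantor set has the
contraction ratio \<open>c^(-M)\<close>.\<close>

lemma hausdorff_dim_D_set_pos: "hausdorff_dim (D_set b c) > 0"
proof -
  obtain M where M: "M > 0"
    and step: "\<forall>n\<ge>N. \<forall>a. is_digits a \<longrightarrow> \<bar>state a n\<bar> \<le> \<rho> \<longrightarrow> forks a n (n + M)"
    using forks_uniformly by blast
  define l where "l = (\<lambda>i. N + i * M)"
  define ok where "ok = (\<lambda>i a. is_digits a \<and> \<bar>state a (l i)\<bar> \<le> \<rho>)"
  define ext where "ext = (\<lambda>i a e. ok (Suc i) e \<and> (\<forall>k<l i. e k = a k))"
  have l_Suc: "l (Suc i) = l i + M" for i by (simp add: l_def)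
  have l_ge: "l i \<ge> N" "l i \<ge> i" for i using M by (auto simp: l_def intro: trans_le_add2)
  have "\<forall>i a. \<exists>e e'. ok i a \<longrightarrow> ext i a e \<and> ext i a e' \<and>
      (2 / (c - 1) + 1) / c ^ l (Suc i) \<le> \<bar>val e (l (Suc i)) - val e' (l (Suc i))\<bar>"
  proof (intro allI)
    fix i a
    show "\<exists>e e'. ok i a \<longrightarrow> ext i a e \<and> ext i a e' \<and>
      (2 / (c - 1) + 1) / c ^ l (Suc i) \<le> \<bar>val e (l (Suc i)) - val e' (l (Suc i))\<bar>"
    proof (cases "ok i a")
      case True
      then have "forks a (l i) (l (Suc i))"
        using step l_ge(1) unfolding ok_def l_Suc by blast
      then show ?thesis unfolding forks_def ext_def ok_def by blast
    qed blast
  qed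
  then obtain F G where FG: "\<And>i a. ok i a \<Longrightarrow> ext i a (F i a)" "\<And>i a. ok i a \<Longrightarrow> ext i a (G i a)"
    "\<And>i a. ok i a \<Longrightarrow> (2 / (c - 1) + 1) / c ^ l (Suc i) \<le> \<bar>val (F i a) (l (Suc i)) - val (G i a) (l (Suc i))\<bar>"
    by metis
  obtain a0 where "is_digits a0" "\<And>n. \<bar>state a0 n\<bar> \<le> 1 / (c - 1)"
    using sign_digits_state_bound by blast
  then have a0: "ok 0 a0" using \<rho>_c unfolding ok_def by (meson order.trans)
  define T where "T = (\<lambda>\<omega> :: nat \<Rightarrow> real. rec_nat a0 (\<lambda>i a. if \<omega> i = 1 then F i a else G i a))"
  have T0: "T \<omega> 0 = a0" and TS: "T \<omega> (Suc i) = (if \<omega> i = 1 then F i (T \<omega> i) else G i (T \<omega> i))" for \<omega> i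
    by (simp_all add: T_def)
  have ok: "ok i (T \<omega> i)" for \<omega> i
    by (induction i) (use a0 FG in \<open>auto simp: T0 TS ext_def\<close>)
  have ext: "ext i (T \<omega> i) (T \<omega> (Suc i))" for \<omega> i
    using FG ok by (simp add: TS)
  have agree: "T \<omega> (i + d) k = T \<omega> i k" if "k < l i" for \<omega> i d k
  proof (induction d)
    case (Suc d)
    have "k < l (i + d)" using that by (simp add: l_def add_mult_distrib)
    then show ?case using ext[of "i + d" \<omega>] Suc by (simp add: ext_def)
  qed simp
  \<comment> \<open>The digit sequence to which the approximations \<open>T \<omega> i\<close> stabilize; position \<open>k\<close> is final from stage \<open>k + 1\<close> on.\<close>
  define X where "X = (\<lambda>\<omega> k. T \<omega> (Suc k) k)"
  have X: "X \<omega> k = T \<omega> i k" if "k < l i" for \<omega> i k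
  proof -
    have "k < l (Suc k)" using l_ge(2)[of "Suc k"] by simp
    then show ?thesis using agree[of k "Suc k" \<omega> "i - Suc k"] agree[of k i \<omega> "Suc k - i"] that
      by (cases "Suc k \<le> i") (auto simp: X_def)
  qed
  have Xdig: "is_digits (X \<omega>)" for \<omega>
    using ok by (simp add: X_def is_digits_def ok_def)
  define x where "x = (\<lambda>\<omega>. \<Sum>k. X \<omega> k / c ^ Suc k)"
  show ?thesis
  proof (rule hausdorff_dim_pos_if_separated)
    show "0 < 1 / c ^ M" "1 / c ^ M < 1" using b bc M by (auto simp: one_less_power)
    show "1 / c ^ (N + M) > 0" using b bc by simp
    show "x \<omega> \<in> D_set b c" for \<omega> unfolding x_def
    proof (rule D_setI[OF Xdig])
      show "filterlim l at_top sequentially"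
        by (rule filterlim_at_top_mono[OF filterlim_ident]) (use l_ge(2) in auto)
      show "\<bar>state (X \<omega>) (l i)\<bar> \<le> \<rho>" for i
      proof -
        have "state (X \<omega>) (l i) = state (T \<omega> i) (l i)" by (rule state_cong) (rule X)
        then show ?thesis using ok by (simp add: ok_def)
      qed
    qed
    fix \<omega> \<omega>' i
    assume dig: "is_digits \<omega>" "is_digits \<omega>'" and eq: "\<And>k. k < i \<Longrightarrow> \<omega> k = \<omega>' k" and neq: "\<omega> i \<noteq> \<omega>' i"
    have "T \<omega> j = T \<omega>' j" if "j \<le> i" for j
      using that by (induction j) (auto simp: T0 TS eq)
    then have same: "T \<omega>' i = T \<omega> i" by simp
    define m where "m = l (Suc i)"
    have cpos: "c > 1" "c ^ m > 0" using b bc by auto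
    have "(\<omega> i = 1 \<and> \<omega>' i = -1) \<or> (\<omega> i = -1 \<and> \<omega>' i = 1)"
    proof -
      have "\<omega> i \<in> {-1, 1}" "\<omega>' i \<in> {-1, 1}" using dig unfolding is_digits_def by blast+
      then show ?thesis using neq by auto
    qed
    then have "(2 / (c - 1) + 1) / c ^ m \<le> \<bar>val (T \<omega> (Suc i)) m - val (T \<omega>' (Suc i)) m\<bar>"
      using FG(3)[OF ok[of i \<omega>]] by (auto simp: TS same m_def abs_minus_commute)
    moreover have "val (X \<omega>) m = val (T \<omega> (Suc i)) m" for \<omega>
      unfolding m_def by (rule val_cong) (rule X)
    ultimately have "(2 / (c - 1) + 1) / c ^ m \<le> \<bar>val (X \<omega>) m - val (X \<omega>') m\<bar>" by simp
    moreover have "\<bar>x \<omega> - val (X \<omega>) m\<bar> \<le> 1 / ((c - 1) * c ^ m)" for \<omega>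
      using digit_tail_bound[OF Xdig cpos(1)] by (simp add: x_def val_def)
    from this[of \<omega>] this[of \<omega>'] have "\<bar>x \<omega> - x \<omega>'\<bar> \<ge> \<bar>val (X \<omega>) m - val (X \<omega>') m\<bar> - 2 * (1 / ((c - 1) * c ^ m))"
      by linarith
    moreover have "(2 / (c - 1) + 1) / c ^ m = 2 * (1 / ((c - 1) * c ^ m)) + 1 / c ^ m"
      using cpos by (simp add: field_simps)
    ultimately have "1 / c ^ m \<le> dist (x \<omega>) (x \<omega>')" by (simp add: dist_real_def)
    also have "1 / c ^ m = 1 / c ^ (N + M) * (1 / c ^ M) ^ i"
      by (simp add: m_def l_def power_add power_one_over power_mult[symmetric] mult.commute)
    finally show "1 / c ^ (N + M) * (1 / c ^ M) ^ i \<le> dist (x \<omega>) (x \<omega>')" .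
  qed
qed

end

context two_bases
begin

lemma hausdorff_dim_D_set_pos_below_golden:
  assumes "b * b < b + 1"
  shows "hausdorff_dim (D_set b c) > 0"
proof -
  define r where "r = max (max (1 / (c - 1)) (2 - 1 / (b + 1))) (if b < 3 / 2 then 2 else 0)"
  have "1 / (c - 1) < 1 / (b - 1)" using b bc by (simp add: frac_less2)
  moreover have "2 - 1 / (b + 1) < 1 / (b - 1)"
  proof -
    have "(2 - 1 / (b + 1)) = (2 * b + 1) / (b + 1)" using b by (simp add: field_simps)
    also have "\<dots> < 1 / (b - 1)" using b assms by (simp add: field_simps)
    finally show ?thesis .
  qed
  moreover have "(if b < 3 / 2 then 2 else 0) < 1 / (b - 1)" using b by (simp add: field_simps)
  ultimately have "r < 1 / (b - 1)" by (simp add: r_def)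
  then have "max (999 / 1000) ((b - 1) * r) < 1" using b by (simp add: field_simps)
  then have "\<forall>\<^sub>F k in sequentially. max (999 / 1000) ((b - 1) * r) < \<mu> k"
    using \<mu>_tendsto order_tendstoD(1) by blast
  then obtain N where N: "max (999 / 1000) ((b - 1) * r) < \<mu> N"
    using eventually_happens' sequentially_bot by blast
  interpret window b c r N
    by unfold_locales (use assms N in \<open>auto simp: r_def\<close>)
  show ?thesis by (rule hausdorff_dim_D_set_pos)
qed

end

lemma D_set_properties:
  fixes b c :: real
  assumes "1 < b" "b < c" "c < 2"
  shows "D_set b c \<noteq> {} \<and> (b < (1 + sqrt 5) / 2 \<longrightarrow> hausdorff_dim (D_set b c) > 0) \<and>
    (c < 1.202 \<longrightarrow> {-1..1} \<subseteq> D_set b c)"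
proof (intro conjI impI)
  interpret two_bases b c by unfold_locales (use assms in auto)
  show "D_set b c \<noteq> {}" by (rule D_set_nonempty)
  show "hausdorff_dim (D_set b c) > 0" if "b < (1 + sqrt 5) / 2"
  proof (rule hausdorff_dim_D_set_pos_below_golden)
    have "(2 * b - 1)\<^sup>2 < (sqrt 5)\<^sup>2" using that assms by (intro power_strict_mono) auto
    then show "b * b < b + 1" by (simp add: power2_eq_square algebra_simps)
  qed
  show "{-1..1} \<subseteq> D_set b c" if "c < 1.202"
  proof -
    have "c \<le> 601 / 500" using that by simp
    then obtain A B where "A \<ge> 0" "B \<ge> 0" "A + B \<le> 2"
      "b ^ Suc 7 = A * b ^ 7 - B" "c ^ Suc 7 = A * c ^ 7 - B"
      by (rule two_term_coefficients[OF assms(1,2)])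
    then show ?thesis using assms by (intro interval_subset_D_set[of A B b c 7]) auto
  qed
qed

theorem theorem1p5:
  fixes \<beta>1 \<beta>2 :: real
  assumes "\<beta>1 \<in> {1<..<2}" and "\<beta>2 \<in> {1<..<2}" and "\<beta>1 \<noteq> \<beta>2"
  shows "D_set \<beta>1 \<beta>2 \<noteq> {} \<and>
    (min \<beta>1 \<beta>2 < (1 + sqrt 5) / 2 \<longrightarrow> hausdorff_dim (D_set \<beta>1 \<beta>2) > 0) \<and>
    (max \<beta>1 \<beta>2 < 1.202 \<longrightarrow> (\<exists>\<delta>>0.664. {-\<delta>..\<delta>} \<subseteq> D_set \<beta>1 \<beta>2))"
proof -
  define b where "b = min \<beta>1 \<beta>2"
  define c where "c = max \<beta>1 \<beta>2"
  have bc: "1 < b" "b < c" "c < 2" using assms by (auto simp: b_def c_def)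
  have D: "D_set \<beta>1 \<beta>2 = D_set b c"
    using D_set_commute[of \<beta>1 \<beta>2] by (auto simp: b_def c_def min_def max_def)
  note props = D_set_properties[OF bc]
  show ?thesis unfolding D
  proof (intro conjI impI)
    show "D_set b c \<noteq> {}" using props by blast
    show "hausdorff_dim (D_set b c) > 0" if "min \<beta>1 \<beta>2 < (1 + sqrt 5) / 2"
      using props that by (simp add: b_def)
    show "\<exists>\<delta>>0.664. {-\<delta>..\<delta>} \<subseteq> D_set b c" if "max \<beta>1 \<beta>2 < 1.202"
      using props that by (intro exI[of _ 1]) (simp add: c_def)
  qed
qed

end
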